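(* Let $w$ be a nonnegative weight function on $[1,\infty)$ and $n\ge1$, with the notation of the context. For the weight function $\mathcal{W}_{-1/2}$ on $G$, the nodes of the minimal cubature rule of degree $4n-1$ $$c_w^2\int_G f(x,y)\,\mathcal{W}_{-\frac12}(x,y)\,dx\,dy=\frac14\sum_{k=1}^n{\sum_{j=1}^{k}}'\lambda_{j,n}\lambda_{k,n}\bigl[f(s_{j,k},t_{j,k})+f(t_{j,k},s_{j,k})+f(-s_{j,k},-t_{j,k})+f(-t_{j,k},-s_{j,k})\bigr],\quad f\in\Pi_{4n-1}^2$$ (where ${\sum}'$ means that the term with $j=k$ is divided by $2$), that is, the points $(s_{j,k},t_{j,k})$, $(t_{j,k},s_{j,k})$, $(-s_{j,k},-t_{j,k})$, $(-t_{j,k},-s_{j,k})$ for $1\le j\le k\le n$, are common zeros of the orthogonal polynomials ${}_1Q_{k,2n}^{(-\frac12)}$, $0\le k\le n$, of degree $2n$ with respect to $\mathcal{W}_{-1/2}$ on $G$.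
   Context: $\Pi_m^2$ is the space of real polynomials in two variables of total degree at most $m$. For a nonnegative weight $W$ on $D\subset\mathbb{R}^2$, $\mathcal{V}_m(W)$ is the space of $P\in\Pi_m^2$ with $\int_D PqW\,dx\,dy=0$ for all $q\in\Pi_{m-1}^2$. $w$ is a nonnegative function on $[1,\infty)$ with $0<\int_1^\infty w<\infty$ and all moments finite; $c_w\int_1^\infty w(x)\,dx=1$. $p_n(w;\cdot)$ is the orthogonal polynomial of degree $n$ with respect to $w$; its zeros $x_{1,n},\dots,x_{n,n}$ are distinct and lie in $(1,\infty)$; $\lambda_{k,n}$ are the weights of the $n$-point Gaussian quadrature for $c_w w(x)\,dx$ at these zeros (exact for polynomials of degree at most $2n-1$). Define $\theta_{k,n}>0$ by $x_{k,n}=\cosh\theta_{k,n}$, and $s_{j,k}=\cosh\frac{\theta_{j,n}-\theta_{k,n}}2$, $t_{j,k}=\cosh\frac{\theta_{j,n}+\theta_{k,n}}2$. Let $\triangle=\{(x,y):1<x<y<\infty\}$ and $\Omega=\{(u,v):u>2,\ u-1<v<u^2/4\}$; $(x,y)\mapsto(x+y,xy)$ is a bijection of $\triangle$ onto $\Omega$. For $(u,v)\in\Omega$ define $W_{-1/2}(u,v)=w(x)w(y)\,|u^2-4v|^{-1/2}$, where $(x,y)\in\triangle$ is determined by $u=x+y$, $v=xy$. Let $G=(-\infty,-1]^2\cup[1,\infty)^2$ and, for almost every $(x,y)\in G$, $\mathcal{W}_{-1/2}(x,y)=W_{-1/2}(2xy,x^2+y^2-1)\,|x^2-y^2|$. $\{P_{k,n}^{(-\frac12)}:0\le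 k\le n\}$ is an orthonormal basis of $\mathcal{V}_n(W_{-1/2})$ (weight on $\Omega$), and ${}_1Q_{k,2n}^{(-\frac12)}(x,y)=P_{k,n}^{(-\frac12)}(2xy,x^2+y^2-1)$. *)

theory Defs
  imports "HOL-Analysis.Analysis" "HOL-Computational_Algebra.Polynomial"
begin

text \<open>
  Polynomials in two variables are represented by their polynomial functions;
  over the reals this loses nothing.
\<close>

definition Pi2 :: "nat \<Rightarrow> (real \<times> real \<Rightarrow> real) set" where
  "Pi2 m = {f. \<exists>a. \<forall>x y. f (x, y) = (\<Sum>i\<le>m. \<Sum>j\<le>m - i. a i j * x ^ i * y ^ j)}"

text \<open>
  The integrability conjunct excludes the convention that the integral of a
  non-integrable function is 0. The range \<open>m' < m\<close> makes the case
  \<open>m = 0\<close> (no orthogonality condition) come out right.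
\<close>

definition orth_polys ::
  "(real \<times> real) set \<Rightarrow> (real \<times> real \<Rightarrow> real) \<Rightarrow> nat \<Rightarrow> (real \<times> real \<Rightarrow> real) set" where
  "orth_polys D W m = {P \<in> Pi2 m. \<forall>m'<m. \<forall>q \<in> Pi2 m'.
     set_integrable lebesgue D (\<lambda>p. P p * q p * W p) \<and>
     (LINT p:D|lebesgue. P p * q p * W p) = 0}"

definition orthonormal_basis ::
  "(real \<times> real) set \<Rightarrow> (real \<times> real \<Rightarrow> real) \<Rightarrow> nat \<Rightarrow> (nat \<Rightarrow> real \<times> real \<Rightarrow> real) \<Rightarrow> bool" where
  "orthonormal_basis D W n P \<longleftrightarrow>
     (\<forall>k\<le>n. P k \<in> orth_polys D W n) \<and>
     (\<forall>j\<le>n. \<forall>k\<le>n. set_integrable lebesgue D (\<lambda>p. P j p * P k p * W p) \<and>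
        (LINT p:D|lebesgue. P j p * P k p * W p) = (if j = k then 1 else 0)) \<and>
     (\<forall>f \<in> orth_polys D W n. \<exists>b. \<forall>p. f p = (\<Sum>k\<le>n. b k * P k p))"

definition cubature_nodes ::
  "(real \<times> real) set \<Rightarrow> (real \<times> real \<Rightarrow> real) \<Rightarrow> nat \<Rightarrow> (real \<times> real) set \<Rightarrow> bool" where
  "cubature_nodes D W m X \<longleftrightarrow> finite X \<and>
     (\<exists>\<omega>. \<forall>f \<in> Pi2 m. set_integrable lebesgue D (\<lambda>p. f p * W p) \<and>
        (LINT p:D|lebesgue. f p * W p) = (\<Sum>p\<in>X. \<omega> p * f p))"

definition minimal_cubature_nodes ::
  "(real \<times> real) set \<Rightarrow> (real \<times> real \<Rightarrow> real) \<Rightarrow> nat \<Rightarrow> (real \<times> real) set \<Rightarrow> bool" where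
  "minimal_cubature_nodes D W m X \<longleftrightarrow> cubature_nodes D W m X \<and>
     (\<forall>Y. cubature_nodes D W m Y \<longrightarrow> card X \<le> card Y)"

text \<open>A weight is a total function of which only the values on \<open>{1..}\<close> matter.\<close>

definition weight_fun :: "(real \<Rightarrow> real) \<Rightarrow> bool" where
  "weight_fun w \<longleftrightarrow> (\<forall>x\<ge>1. 0 \<le> w x) \<and>
     (\<forall>k::nat. set_integrable lebesgue {1..} (\<lambda>x. x ^ k * w x)) \<and>
     0 < (LINT x:{1..}|lebesgue. w x)"

definition c_w :: "(real \<Rightarrow> real) \<Rightarrow> real" where
  "c_w w = 1 / (LINT x:{1..}|lebesgue. w x)"

definition orth_poly_deg :: "(real \<Rightarrow> real) \<Rightarrow> nat \<Rightarrow> real poly \<Rightarrow> bool" where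
  "orth_poly_deg w n p \<longleftrightarrow> p \<noteq> 0 \<and> degree p = n \<and>
     (\<forall>q. degree q < n \<longrightarrow> (LINT x:{1..}|lebesgue. poly p x * poly q x * w x) = 0)"

definition gauss_weights :: "(real \<Rightarrow> real) \<Rightarrow> nat \<Rightarrow> (nat \<Rightarrow> real) \<Rightarrow> (nat \<Rightarrow> real) \<Rightarrow> bool" where
  "gauss_weights w n x lam \<longleftrightarrow>
     (\<forall>q. degree q \<le> 2 * n - 1 \<longrightarrow>
        c_w w * (LINT t:{1..}|lebesgue. poly q t * w t) = (\<Sum>k=1..n. lam k * poly q (x k)))"

definition triangle_dom :: "(real \<times> real) set" where
  "triangle_dom = {(x, y). 1 < x \<and> x < y}"

definition Omega :: "(real \<times> real) set" where
  "Omega = {(u, v). 2 < u \<and> u - 1 < v \<and> v < u\<^sup>2 / 4}"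

definition G_dom :: "(real \<times> real) set" where
  "G_dom = {..-1} \<times> {..-1} \<union> {1..} \<times> {1..}"

text \<open>
  On \<open>Omega\<close>, \<open>inv_into\<close> inverts the bijection from \<open>triangle_dom\<close>
  onto \<open>Omega\<close>; off \<open>Omega\<close> the value is unspecified.
\<close>

definition W_mhalf :: "(real \<Rightarrow> real) \<Rightarrow> real \<times> real \<Rightarrow> real" where
  "W_mhalf w = (\<lambda>(u, v).
     let (x, y) = inv_into triangle_dom (\<lambda>(x, y). (x + y, x * y)) (u, v)
     in w x * w y * \<bar>u\<^sup>2 - 4 * v\<bar> powr (-1/2))"

text \<open>
  On \<open>G_dom\<close> the argument of \<open>W_mhalf\<close> lies in \<open>Omega\<close> unless
  \<open>x = y\<close> or \<open>\<bar>x\<bar> = 1\<close> or \<open>\<bar>y\<bar> = 1\<close>, a null set.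
\<close>

definition W_cal :: "(real \<Rightarrow> real) \<Rightarrow> real \<times> real \<Rightarrow> real" where
  "W_cal w = (\<lambda>(x, y). W_mhalf w (2 * x * y, x\<^sup>2 + y\<^sup>2 - 1) * \<bar>x\<^sup>2 - y\<^sup>2\<bar>)"

definition Q1 :: "(real \<times> real \<Rightarrow> real) \<Rightarrow> real \<times> real \<Rightarrow> real" where
  "Q1 P = (\<lambda>(x, y). P (2 * x * y, x\<^sup>2 + y\<^sup>2 - 1))"

definition s_node :: "(nat \<Rightarrow> real) \<Rightarrow> nat \<Rightarrow> nat \<Rightarrow> real" where
  "s_node \<theta> j k = cosh ((\<theta> j - \<theta> k) / 2)"

definition t_node :: "(nat \<Rightarrow> real) \<Rightarrow> nat \<Rightarrow> nat \<Rightarrow> real" where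
  "t_node \<theta> j k = cosh ((\<theta> j + \<theta> k) / 2)"

definition cub_nodes :: "(nat \<Rightarrow> real) \<Rightarrow> nat \<Rightarrow> (real \<times> real) set" where
  "cub_nodes \<theta> n = (\<Union>k\<in>{1..n}. \<Union>j\<in>{1..k}.
     {(s_node \<theta> j k, t_node \<theta> j k), (t_node \<theta> j k, s_node \<theta> j k),
      (- s_node \<theta> j k, - t_node \<theta> j k), (- t_node \<theta> j k, - s_node \<theta> j k)})"

end

(* Under (x, y) |-> (2xy, x^2 + y^2 - 1) each of the four congruent pieces of G is mapped bijectively
   onto Omega, and the triangle is mapped onto Omega by (X, Y) |-> (X + Y, XY); the Jacobians cancel
   the factors in the weights. A polynomial f averaged over the symmetries (x, y) -> (y, x) and
   (x, y) -> (-x, -y) of the weight is A(2xy, x^2 + y^2 - 1) with deg A <= deg f / 2, so its integral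
   over G is an integral of A(X + Y, XY) against w(X) w(Y), where the product Gauss rule is exact.
   The nodes are matched by 2st = x_j + x_k, s^2 + t^2 - 1 = x_j x_k.

   An orthogonal P on Omega gives P(X + Y, XY), orthogonal to all symmetric polynomials of degree < n
   in each variable; testing against symmetrized products of Lagrange polynomials shows that it
   vanishes at the pairs (x_j, x_k).

   Minimality is Moeller's lower bound. If a rule had fewer than 2n(n + 1) nodes, there would be P, Q
   of degree <= 2n, not both 0, vanishing at the nodes, with deg(xP + yQ) <= 2n. By central symmetry
   and exactness P and Q are even, so R = xP + yQ is odd of degree <= 2n - 1 and vanishes at the nodes;
   hence the integral of R^2 is 0 and R = 0. Thus P = yT, Q = -xT with T odd, T vanishes at the
   nodes as well, and the same argument gives T = 0. *)
theory Submission
  imports Defs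
begin

section \<open>Polynomials in two variables\<close>

text \<open>Two notions of degree are in play: total degree on G and Omega, degree in each variable
  for the product Gauss rule. \<open>bipoly K\<close>, spanned by the monomials with exponents in
  \<open>K\<close>, covers both, and its induction rule reduces linear claims to monomials. The
  degrees match because symmetrizing takes 4n - 1 to 2n - 1, while \<open>x + y\<close> and
  \<open>x * y\<close> both have degree 1 in each variable, so that 2n - 1 is exactly what the Gauss
  rule integrates. The bound 2n(n + 1) is half a dimension: the admissible pairs (P, Q) of degree at
  most N = 2n form a space of dimension N(N + 2), and each node imposes two conditions. The analytic
  obstacle is that the weight is merely Lebesgue measurable, that \<open>W_cal\<close> is
  unspecified on a null set, and that a non-integrable function has integral 0. Changes of variables
  are therefore paired with an equivalence of integrability, and product integrals go through Borel
  representatives. A polynomial on G need not factor through the map to Omega, so its integrability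
  comes from a majorant that does.\<close>

inductive_set bipoly :: "(nat \<times> nat) set \<Rightarrow> (real \<times> real \<Rightarrow> real) set"
  for K :: "(nat \<times> nat) set" where
  zero: "(\<lambda>p. 0) \<in> bipoly K"
| monom: "(i, j) \<in> K \<Longrightarrow> (\<lambda>p. c * fst p ^ i * snd p ^ j) \<in> bipoly K"
| add: "f \<in> bipoly K \<Longrightarrow> g \<in> bipoly K \<Longrightarrow> (\<lambda>p. f p + g p) \<in> bipoly K"

lemma bipoly_sum:
  "(\<And>i. i \<in> I \<Longrightarrow> F i \<in> bipoly K) \<Longrightarrow> (\<lambda>p. \<Sum>i\<in>I. F i p) \<in> bipoly K"
proof (induction I rule: infinite_finite_induct)
  case (insert x I)
  then show ?case by (simp add: bipoly.add)
qed (auto intro: bipoly.zero)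

lemma bipoly_scale: "f \<in> bipoly K \<Longrightarrow> (\<lambda>p. c * f p) \<in> bipoly K"
proof (induction rule: bipoly.induct)
  case (monom i j b)
  then show ?case using bipoly.monom[of i j K "c * b"] by (simp add: mult.assoc)
qed (auto simp: distrib_left intro: bipoly.intros)

lemma bipoly_mono: "f \<in> bipoly K \<Longrightarrow> K \<subseteq> L \<Longrightarrow> f \<in> bipoly L"
  by (induction rule: bipoly.induct) (auto intro: bipoly.intros)

lemma bipoly_mult:
  assumes "f \<in> bipoly K" "g \<in> bipoly L"
    and sub: "\<And>i j k l. (i, j) \<in> K \<Longrightarrow> (k, l) \<in> L \<Longrightarrow> (i + k, j + l) \<in> M"
  shows "(\<lambda>p. f p * g p) \<in> bipoly M"
  using assms(1)
proof (induction rule: bipoly.induct)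
  case (monom i j c)
  show ?case using assms(2)
  proof (induction rule: bipoly.induct)
    case (monom k l d)
    have "(\<lambda>p. (c * d) * fst p ^ (i + k) * snd p ^ (j + l)) \<in> bipoly M"
      using sub[OF \<open>(i, j) \<in> K\<close> monom] by (rule bipoly.monom)
    then show ?case by (simp add: power_add algebra_simps)
  qed (auto simp: distrib_left intro: bipoly.intros)
qed (auto simp: distrib_right intro: bipoly.intros)

abbreviation tri :: "nat \<Rightarrow> (nat \<times> nat) set" where
  "tri m \<equiv> {(i, j). i + j \<le> m}"

abbreviation box2 :: "nat \<Rightarrow> (nat \<times> nat) set" where
  "box2 m \<equiv> {..m} \<times> {..m}"

lemma Pi2_eq_bipoly: "Pi2 m = bipoly (tri m)"
proof (intro equalityI subsetI)
  fix f assume "f \<in> Pi2 m"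
  then obtain a where a: "\<And>x y. f (x, y) = (\<Sum>i\<le>m. \<Sum>j\<le>m - i. a i j * x ^ i * y ^ j)"
    unfolding Pi2_def by blast
  have "f = (\<lambda>p. \<Sum>i\<le>m. \<Sum>j\<le>m - i. a i j * fst p ^ i * snd p ^ j)"
    by (auto simp: a)
  also have "\<dots> \<in> bipoly (tri m)"
    by (intro bipoly_sum bipoly.monom) auto
  finally show "f \<in> bipoly (tri m)" .
next
  fix f assume "f \<in> bipoly (tri m)"
  then show "f \<in> Pi2 m"
  proof (induction rule: bipoly.induct)
    case zero
    show ?case by (auto simp: Pi2_def intro!: exI[of _ "\<lambda>_ _. 0"])
  next
    case (monom i j c)
    have "c * x ^ i * y ^ j =
        (\<Sum>i'\<le>m. \<Sum>j'\<le>m - i'. (if i' = i \<and> j' = j then c else 0) * x ^ i' * y ^ j')" for x y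
    proof -
      have "(\<Sum>i'\<le>m. \<Sum>j'\<le>m - i'. (if i' = i \<and> j' = j then c else 0) * x ^ i' * y ^ j')
          = (\<Sum>i'\<le>m. if i' = i then (\<Sum>j'\<le>m - i. if j' = j then c * x ^ i * y ^ j else 0) else 0)"
        by (intro sum.cong refl) (simp add: if_distrib[where f = "\<lambda>t. t * _"] cong: if_cong)
      also have "\<dots> = c * x ^ i * y ^ j" using monom by simp
      finally show ?thesis by simp
    qed
    then show ?case unfolding Pi2_def by auto
  next
    case (add f g)
    then obtain a b where a: "\<And>x y. f (x, y) = (\<Sum>i\<le>m. \<Sum>j\<le>m - i. a i j * x ^ i * y ^ j)"
      and b: "\<And>x y. g (x, y) = (\<Sum>i\<le>m. \<Sum>j\<le>m - i. b i j * x ^ i * y ^ j)"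
      unfolding Pi2_def by blast
    have "f (x, y) + g (x, y) = (\<Sum>i\<le>m. \<Sum>j\<le>m - i. (a i j + b i j) * x ^ i * y ^ j)" for x y
      by (simp add: a b sum.distrib distrib_right)
    then show ?case unfolding Pi2_def by (auto intro!: exI[of _ "\<lambda>i j. a i j + b i j"])
  qed
qed

lemma Pi2_mono: "f \<in> Pi2 m \<Longrightarrow> m \<le> m' \<Longrightarrow> f \<in> Pi2 m'"
  unfolding Pi2_eq_bipoly by (erule bipoly_mono) auto

lemma Pi2_mult: "f \<in> Pi2 m \<Longrightarrow> g \<in> Pi2 k \<Longrightarrow> (\<lambda>p. f p * g p) \<in> Pi2 (m + k)"
  unfolding Pi2_eq_bipoly by (erule (1) bipoly_mult) auto

lemma Pi2_add: "f \<in> Pi2 m \<Longrightarrow> g \<in> Pi2 m \<Longrightarrow> (\<lambda>p. f p + g p) \<in> Pi2 m"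
  unfolding Pi2_eq_bipoly by (rule bipoly.add)

lemma Pi2_scale: "f \<in> Pi2 m \<Longrightarrow> (\<lambda>p. c * f p) \<in> Pi2 m"
  unfolding Pi2_eq_bipoly by (rule bipoly_scale)

lemma Pi2_monom: "i + j \<le> m \<Longrightarrow> (\<lambda>p. c * fst p ^ i * snd p ^ j) \<in> Pi2 m"
  unfolding Pi2_eq_bipoly by (rule bipoly.monom) auto

lemma Pi2_const: "(\<lambda>p. c) \<in> Pi2 m"
  using Pi2_monom[of 0 0 m c] by simp

lemma Pi2_fst: "1 \<le> m \<Longrightarrow> fst \<in> Pi2 m"
  using Pi2_monom[of 1 0 m 1] by simp

lemma Pi2_snd: "1 \<le> m \<Longrightarrow> snd \<in> Pi2 m"
  using Pi2_monom[of 0 1 m 1] by simp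

text \<open>\<open>K\<close> stands for a filtration of the exponents by degree that is compatible
  with addition. Both \<open>tri\<close> and \<open>box2\<close> are instances, so one substitution
  argument serves both notions of degree.\<close>

lemma bipoly_power:
  fixes K :: "nat \<Rightarrow> (nat \<times> nat) set"
  assumes K0: "(0, 0) \<in> K 0"
    and Kadd: "\<And>d e i j k l. (i, j) \<in> K d \<Longrightarrow> (k, l) \<in> K e \<Longrightarrow> (i + k, j + l) \<in> K (d + e)"
    and f: "f \<in> bipoly (K d)"
  shows "(\<lambda>p. f p ^ r) \<in> bipoly (K (r * d))"
proof (induction r)
  case 0
  show ?case using bipoly.monom[OF K0, of 1] by simp
next
  case (Suc r)
  have "(\<lambda>p. f p * f p ^ r) \<in> bipoly (K (d + r * d))"
    by (rule bipoly_mult[OF f Suc Kadd])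
  then show ?case by simp
qed

lemma bipoly_subst:
  fixes K :: "nat \<Rightarrow> (nat \<times> nat) set"
  assumes K0: "(0, 0) \<in> K 0"
    and Kadd: "\<And>d e i j k l. (i, j) \<in> K d \<Longrightarrow> (k, l) \<in> K e \<Longrightarrow> (i + k, j + l) \<in> K (d + e)"
    and Kmono: "\<And>d e. d \<le> e \<Longrightarrow> K d \<subseteq> K e"
    and X: "X \<in> bipoly (K d)" and Y: "Y \<in> bipoly (K d)"
    and f: "f \<in> Pi2 m"
  shows "(\<lambda>p. f (X p, Y p)) \<in> bipoly (K (m * d))"
  using f unfolding Pi2_eq_bipoly
proof (induction rule: bipoly.induct)
  case (monom i j c)
  have "(\<lambda>p. X p ^ i * Y p ^ j) \<in> bipoly (K (i * d + j * d))"
    by (rule bipoly_mult[OF bipoly_power[OF K0 Kadd X] bipoly_power[OF K0 Kadd Y] Kadd])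
  moreover have "i * d + j * d \<le> m * d"
    using monom by (auto simp flip: distrib_right)
  ultimately have "(\<lambda>p. X p ^ i * Y p ^ j) \<in> bipoly (K (m * d))"
    by (blast intro: bipoly_mono dest: Kmono)
  then show ?case using bipoly_scale[of "\<lambda>p. X p ^ i * Y p ^ j" _ c] by (simp add: mult.assoc)
qed (auto intro: bipoly.intros)

lemma Pi2_subst:
  assumes "X \<in> Pi2 d" "Y \<in> Pi2 d" "f \<in> Pi2 m"
  shows "(\<lambda>p. f (X p, Y p)) \<in> Pi2 (m * d)"
  using assms unfolding Pi2_eq_bipoly[of d] Pi2_eq_bipoly[of "m * d"]
  by (intro bipoly_subst[where K = tri]) auto

text \<open>In each variable separately \<open>x * y\<close> has degree 1, the same as
  \<open>x + y\<close>; measured by total degree it would have degree 2 and the bound would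
  double.\<close>

lemma box_subst_elementary:
  assumes "f \<in> Pi2 m"
  shows "(\<lambda>p. f (fst p + snd p, fst p * snd p)) \<in> bipoly (box2 m)"
proof -
  have "(\<lambda>p. fst p + snd p) \<in> bipoly (box2 1)"
    using bipoly.add[OF bipoly.monom[of 1 0 "box2 1" 1] bipoly.monom[of 0 1 "box2 1" 1]] by simp
  moreover have "(\<lambda>p. fst p * snd p) \<in> bipoly (box2 1)"
    using bipoly.monom[of 1 1 "box2 1" 1] by simp
  ultimately have "(\<lambda>p. f (fst p + snd p, fst p * snd p)) \<in> bipoly (box2 (m * 1))"
    using assms by (intro bipoly_subst[where K = box2]) auto
  then show ?thesis by simp
qed

lemma Q1_in_Pi2:
  assumes "f \<in> Pi2 m"
  shows "Q1 f \<in> Pi2 (2 * m)"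
proof -
  have 1: "(\<lambda>p. 2 * fst p * snd p) \<in> Pi2 2"
    using Pi2_monom[of 1 1 2 2] by simp
  have 2: "(\<lambda>p. (fst p)\<^sup>2 + (snd p)\<^sup>2 - 1) \<in> Pi2 2"
    using Pi2_add[OF Pi2_add[OF Pi2_monom[of 2 0 2 1] Pi2_monom[of 0 2 2 1]] Pi2_const[of "-1"]] by simp
  show ?thesis using Pi2_subst[OF 1 2 assms]
    by (simp add: Q1_def case_prod_unfold mult.commute)
qed

lemma bipoly_section:
  assumes "f \<in> bipoly K"
  shows "\<exists>q. \<forall>y. f (x, y) = poly q y" "\<exists>q. \<forall>x. f (x, y) = poly q x"
proof -
  show "\<exists>q. \<forall>y. f (x, y) = poly q y" using assms
  proof (induction rule: bipoly.induct)
    case (monom i j c)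
    show ?case by (intro exI[of _ "Polynomial.monom (c * x ^ i) j"]) (simp add: poly_monom)
  next
    case (add f g)
    then show ?case by (metis poly_add)
  qed (auto intro: exI[of _ 0])
  show "\<exists>q. \<forall>x. f (x, y) = poly q x" using assms
  proof (induction rule: bipoly.induct)
    case (monom i j c)
    show ?case by (intro exI[of _ "Polynomial.monom (c * y ^ j) i"]) (simp add: poly_monom)
  next
    case (add f g)
    then show ?case by (metis poly_add)
  qed (auto intro: exI[of _ 0])
qed

lemma poly_infinite_zeros:
  fixes q :: "real poly"
  assumes "infinite A" "\<And>x. x \<in> A \<Longrightarrow> poly q x = 0"
  shows "q = 0"
  using assms poly_roots_finite[of q] finite_subset[of A "{x. poly q x = 0}"] by blast

text \<open>One use is cancellation: an identity known only off a coordinate axis extends across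
  it.\<close>

lemma bipoly_eq_0_on_rectangle:
  assumes f: "f \<in> bipoly K" and A: "infinite A" and B: "infinite B"
    and z: "\<And>x y. x \<in> A \<Longrightarrow> y \<in> B \<Longrightarrow> f (x, y) = 0"
  shows "f (x, y) = 0"
proof -
  have 1: "f (a, y) = 0" if "a \<in> A" for a
  proof -
    obtain q where q: "\<And>y. f (a, y) = poly q y" using bipoly_section[OF f] by metis
    then have "q = 0" using poly_infinite_zeros[OF B] z[OF that] by metis
    then show ?thesis by (simp add: q)
  qed
  obtain q where q: "\<And>x. f (x, y) = poly q x" using bipoly_section[OF f] by metis
  then have "q = 0" using poly_infinite_zeros[OF A] 1 by metis
  then show ?thesis by (simp add: q)
qed

lemma bipoly_coeffs_eq_0:
  assumes z: "\<And>x y. (\<Sum>i\<le>m. \<Sum>j\<le>m - i. a i j * x ^ i * y ^ j) = (0::real)"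
    and "i + j \<le> m"
  shows "a i j = 0"
proof -
  have 1: "(\<Sum>j\<le>m - i. a i j * y ^ j) = 0" for y
  proof -
    have "(\<Sum>i\<le>m. (\<Sum>j\<le>m - i. a i j * y ^ j) * x ^ i) = 0" for x
      using z[of x y] by (simp add: sum_distrib_left sum_distrib_right mult_ac)
    then show ?thesis using assms(2) polyfun_eq_0[of "\<lambda>i. \<Sum>j\<le>m - i. a i j * y ^ j" m] by auto
  qed
  then show ?thesis using polyfun_eq_0[of "a i" "m - i"] assms(2) by auto
qed

section \<open>Linear systems and Moeller's lower bound\<close>

lemma homogeneous_system_nontrivial:
  fixes a :: "'j \<Rightarrow> 'i \<Rightarrow> real"
  assumes "finite J" "finite I" "card J < card I"
  shows "\<exists>z. (\<exists>i\<in>I. z i \<noteq> 0) \<and> (\<forall>j\<in>J. (\<Sum>i\<in>I. z i * a j i) = 0)"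
  using assms
proof (induction J arbitrary: I a rule: finite_induct)
  case empty
  then show ?case by (intro exI[of _ "\<lambda>_. 1"]) (auto simp: card_gt_0_iff)
next
  case (insert j J)
  show ?case
  proof (cases "\<forall>i\<in>I. a j i = 0")
    case True
    obtain z where "\<exists>i\<in>I. z i \<noteq> 0" "\<forall>j\<in>J. (\<Sum>i\<in>I. z i * a j i) = 0"
      using insert.IH[of I a] insert.prems insert.hyps by auto
    with True show ?thesis by (intro exI[of _ z]) auto
  next
    case False
    then obtain i0 where i0: "i0 \<in> I" "a j i0 \<noteq> 0" by auto
    \<comment> \<open>Equation \<open>j\<close> is solved for the unknown \<open>i0\<close>;
      \<open>b\<close> is what the other equations become after substitution.\<close>
    define b where "b = (\<lambda>k i. a k i - a k i0 * a j i / a j i0)"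
    have "card J < card (I - {i0})"
      using insert.prems insert.hyps i0 by (simp add: card_Diff_singleton)
    then obtain z where z: "\<exists>i\<in>I - {i0}. z i \<noteq> 0"
      and sol: "\<forall>k\<in>J. (\<Sum>i\<in>I - {i0}. z i * b k i) = 0"
      using insert.IH[of "I - {i0}" b] insert.prems by auto
    define s where "s = (\<Sum>i\<in>I - {i0}. z i * a j i)"
    define y where "y = z(i0 := - s / a j i0)"
    have split: "(\<Sum>i\<in>I. y i * a k i) = - s / a j i0 * a k i0 + (\<Sum>i\<in>I - {i0}. z i * a k i)" for k
    proof -
      have "(\<Sum>i\<in>I - {i0}. y i * a k i) = (\<Sum>i\<in>I - {i0}. z i * a k i)"
        by (intro sum.cong) (auto simp: y_def)
      then show ?thesis
        using sum.remove[of I i0 "\<lambda>i. y i * a k i"] insert.prems i0 by (simp add: y_def)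
    qed
    have "(\<Sum>i\<in>I. y i * a k i) = 0" if "k \<in> insert j J" for k
    proof (cases "k = j")
      case True
      then show ?thesis using i0 by (simp add: split s_def)
    next
      case False
      have "(\<Sum>i\<in>I - {i0}. z i * b k i) =
          (\<Sum>i\<in>I - {i0}. z i * a k i - (a k i0 / a j i0) * (z i * a j i))"
        by (intro sum.cong refl) (simp add: b_def right_diff_distrib mult_ac)
      also have "\<dots> = (\<Sum>i\<in>I - {i0}. z i * a k i) - a k i0 / a j i0 * s"
        by (simp add: sum_subtractf s_def sum_distrib_left sum_divide_distrib)
      finally show ?thesis using sol that False by (simp add: split mult_ac)
    qed
    moreover have "\<exists>i\<in>I. y i \<noteq> 0" using z by (auto simp: y_def)
    ultimately show ?thesis by blast
  qed
qed

text \<open>The first sum is homogeneous of degree \<open>N\<close> and the second has degree below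
  \<open>N\<close>, so no monomial occurs twice and all coefficients can be read off.\<close>

lemma homogeneous_part_coeffs_eq_0:
  fixes t :: "nat \<Rightarrow> real" and a :: "nat \<times> nat \<Rightarrow> real"
  assumes z: "\<And>x y. (\<Sum>i<N. t i * (x ^ i * y ^ (N - i))) +
    (\<Sum>(i, j)\<in>Sigma {..<N} (\<lambda>i. {..<N - i}). a (i, j) * (x ^ i * y ^ j)) = 0"
  shows "\<And>i. i < N \<Longrightarrow> t i = 0"
    and "\<And>i j. (i, j) \<in> Sigma {..<N} (\<lambda>i. {..<N - i}) \<Longrightarrow> a (i, j) = 0"
proof -
  \<comment> \<open>\<open>x ^ N\<close> is the one monomial of degree \<open>N\<close> absent from
    the first sum, as every term there contains a power of \<open>y\<close>; its coefficient is set
    to 0.\<close>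
  define c where "c = (\<lambda>i j. if i + j = N then (if i < N then t i else 0) else a (i, j))"
  have "(\<Sum>i\<le>N. \<Sum>j\<le>N - i. c i j * x ^ i * y ^ j) = 0" for x y
  proof -
    have last: "sum g {..k} = sum g {..<k} + g k" for g :: "nat \<Rightarrow> real" and k
      by (simp flip: lessThan_Suc_atMost)
    have "(\<Sum>j\<le>N - i. c i j * x ^ i * y ^ j) =
        (\<Sum>j<N - i. a (i, j) * (x ^ i * y ^ j)) + t i * (x ^ i * y ^ (N - i))" if "i < N" for i
      using that unfolding last by (auto simp: c_def mult.assoc intro!: sum.cong)
    then have "(\<Sum>i<N. \<Sum>j\<le>N - i. c i j * x ^ i * y ^ j) =
        (\<Sum>i<N. (\<Sum>j<N - i. a (i, j) * (x ^ i * y ^ j)) + t i * (x ^ i * y ^ (N - i)))"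
      by (intro sum.cong) auto
    also have "\<dots> = 0"
      using z[of x y] by (simp add: sum.distrib sum.Sigma)
    finally have "(\<Sum>i<N. \<Sum>j\<le>N - i. c i j * x ^ i * y ^ j) = 0" .
    moreover have "(\<Sum>j\<le>N - N. c N j * x ^ N * y ^ j) = 0" by (simp add: c_def)
    ultimately show ?thesis
      using last[of "\<lambda>i. \<Sum>j\<le>N - i. c i j * x ^ i * y ^ j" N] by simp
  qed
  then have c0: "c i j = 0" if "i + j \<le> N" for i j
    using bipoly_coeffs_eq_0[where m = N and a = c and i = i and j = j] that by blast
  show "t i = 0" if "i < N" for i
    using c0[of i "N - i"] that by (simp add: c_def)
  show "a (i, j) = 0" if "(i, j) \<in> Sigma {..<N} (\<lambda>i. {..<N - i})" for i j
    proof -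
    have "i + j < N" using that by auto
    then show ?thesis using c0[of i j] by (simp add: c_def)
  qed
qed

text \<open>These are the exponents of the polynomials of degree at most \<open>N - 1\<close>. Two
  such families and the \<open>N\<close> coefficients of a homogeneous \<open>h\<close> add up to
  \<open>N * (N + 2)\<close>.\<close>

lemma card_staircase: "2 * card (Sigma {..<N} (\<lambda>i. {..<N - i})) = N * (N + 1)"
proof -
  have "2 * (\<Sum>i<N. N - i) = N * (N + 1)" for N :: nat
  proof (induction N)
    case (Suc N)
    then show ?case by (simp add: sum.lessThan_Suc_shift del: sum.lessThan_Suc)
  qed simp
  then show ?thesis by (simp add: card_SigmaI)
qed

text \<open>The pairs \<open>(y h + P, - x h + Q)\<close> with \<open>h\<close> homogeneous of degree \<open>N - 1\<close> are exactly those
  of degree at most \<open>N\<close> for which \<open>x\<close> times the first plus \<open>y\<close> times the second component has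
  degree at most \<open>N\<close>; they form a space of dimension \<open>N (N + 2)\<close>.\<close>

lemma syzygy_vanishing_on:
  fixes Y :: "(real \<times> real) set"
  assumes fin: "finite Y" and card: "2 * card Y < N * (N + 2)" and N: "1 \<le> N"
  obtains h P Q where "h \<in> Pi2 (N - 1)" "P \<in> Pi2 (N - 1)" "Q \<in> Pi2 (N - 1)"
    "\<forall>p\<in>Y. snd p * h p + P p = 0" "\<forall>p\<in>Y. - fst p * h p + Q p = 0"
    "\<not> ((\<forall>p. snd p * h p + P p = 0) \<and> (\<forall>p. - fst p * h p + Q p = 0))"
proof -
  let ?T = "Sigma {..<N} (\<lambda>i. {..<N - i})"
  \<comment> \<open>The unknowns are the coefficients of \<open>h\<close>, of \<open>P\<close> and
    of \<open>Q\<close>, in this order.\<close>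
  let ?I = "({..<N} <+> ?T) <+> ?T"
  define mon where "mon = (\<lambda>(i, j) p. fst p ^ i * snd p ^ j :: real)"
  \<comment> \<open>Row \<open>Inl p\<close> makes the first component vanish at \<open>p\<close>,
    row \<open>Inr p\<close> the second. The coefficients of \<open>h\<close> enter both, since the
    top-degree parts are tied together as \<open>y * h\<close> and \<open>- x * h\<close>.\<close>
  define col where "col = (\<lambda>k i. case k of
      Inl p \<Rightarrow> (case i of Inl (Inl i) \<Rightarrow> fst p ^ i * snd p ^ (N - i) | Inl (Inr ij) \<Rightarrow> mon ij p | Inr _ \<Rightarrow> 0)
    | Inr p \<Rightarrow> (case i of Inl (Inl i) \<Rightarrow> - (fst p ^ Suc i * snd p ^ (N - 1 - i)) | Inl (Inr _) \<Rightarrow> 0 | Inr ij \<Rightarrow> mon ij p))"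
  have "card ?I = N + 2 * card ?T" by (simp add: card_Plus)
  then have "card ?I = N * (N + 2)" using card_staircase[of N] by simp
  then have "card (Y <+> Y) < card ?I" using card fin by (simp add: card_Plus)
  then obtain z where nz: "\<exists>i\<in>?I. z i \<noteq> 0" and sol: "\<And>k. k \<in> Y <+> Y \<Longrightarrow> (\<Sum>i\<in>?I. z i * col k i) = 0"
    using homogeneous_system_nontrivial[of "Y <+> Y" ?I col] fin by auto
  define t where "t = (\<lambda>i. z (Inl (Inl i)))"
  define a where "a = (\<lambda>i. z (Inl (Inr i)))"
  define b where "b = (\<lambda>i. z (Inr i))"
  define h where "h = (\<lambda>p. \<Sum>i<N. t i * fst p ^ i * snd p ^ (N - 1 - i))"
  define P where "P = (\<lambda>p. \<Sum>ij\<in>?T. a ij * fst p ^ fst ij * snd p ^ snd ij)"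
  define Q where "Q = (\<lambda>p. \<Sum>ij\<in>?T. b ij * fst p ^ fst ij * snd p ^ snd ij)"
  have yh: "snd p * h p = (\<Sum>i<N. t i * (fst p ^ i * snd p ^ (N - i)))" for p
    unfolding h_def sum_distrib_left
  proof (intro sum.cong refl)
    fix i assume "i \<in> {..<N}"
    then have "snd p ^ (N - i) = snd p * snd p ^ (N - 1 - i)"
      by (metis Suc_diff_Suc diff_Suc_eq_diff_pred lessThan_iff power_Suc)
    then show "snd p * (t i * fst p ^ i * snd p ^ (N - 1 - i)) = t i * (fst p ^ i * snd p ^ (N - i))"
      by simp
  qed
  have xh: "- fst p * h p = (\<Sum>i<N. t i * (- (fst p ^ Suc i * snd p ^ (N - 1 - i))))" for p
    unfolding h_def sum_distrib_left by (intro sum.cong refl) simp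
  have eqP: "(\<Sum>i\<in>?I. z i * col (Inl p) i) = snd p * h p + P p" for p
    unfolding yh by (simp add: sum.Plus col_def t_def a_def P_def mon_def case_prod_unfold mult.assoc)
  have eqQ: "(\<Sum>i\<in>?I. z i * col (Inr p) i) = - fst p * h p + Q p" for p
    unfolding xh by (simp add: sum.Plus col_def t_def b_def Q_def mon_def case_prod_unfold mult.assoc)
  have "\<not> ((\<forall>p. snd p * h p + P p = 0) \<and> (\<forall>p. - fst p * h p + Q p = 0))"
  proof
    \<comment> \<open>The parametrization is injective: the first component determines
      \<open>h\<close> and \<open>P\<close>, and once \<open>h = 0\<close> the second is just
      \<open>Q\<close>.\<close>
    assume *: "(\<forall>p. snd p * h p + P p = 0) \<and> (\<forall>p. - fst p * h p + Q p = 0)"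
    have "(\<Sum>i<N. t i * (x ^ i * y ^ (N - i))) + (\<Sum>(i, j)\<in>?T. a (i, j) * (x ^ i * y ^ j)) = 0" for x y
      using conjunct1[OF *, rule_format, of "(x, y)"] unfolding yh
      by (simp add: P_def case_prod_unfold mult.assoc)
    note c = homogeneous_part_coeffs_eq_0[OF this]
    have h0: "h p = 0" for p using c(1) by (simp add: h_def)
    have "(\<Sum>i<N. (\<lambda>_. 0) i * (x ^ i * y ^ (N - i))) + (\<Sum>(i, j)\<in>?T. b (i, j) * (x ^ i * y ^ j)) = 0" for x y
      using conjunct2[OF *, rule_format, of "(x, y)"]
      by (simp add: h0 Q_def case_prod_unfold mult.assoc)
    note d = homogeneous_part_coeffs_eq_0(2)[OF this]
    show False using nz c d by (auto simp: t_def a_def b_def)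
  qed
  moreover have "h \<in> Pi2 (N - 1)" "P \<in> Pi2 (N - 1)" "Q \<in> Pi2 (N - 1)"
    unfolding h_def P_def Q_def Pi2_eq_bipoly
    by (intro bipoly_sum bipoly.monom; use N in auto)+
  moreover have "snd p * h p + P p = 0" "- fst p * h p + Q p = 0" if "p \<in> Y" for p
    using sol[of "Inl p"] sol[of "Inr p"] that unfolding eqP eqQ by auto
  ultimately show ?thesis using that by blast
qed

text \<open>For even \<open>m\<close> the monomials of degree exactly \<open>m\<close> are even
  functions and cancel in the difference. This gain of one degree brings products with the odd part
  within the exactness of the rule.\<close>

lemma Pi2_reflect_parts:
  assumes "f \<in> Pi2 m"
  shows "(\<lambda>p. f p + f (- p)) \<in> Pi2 m" and "even m \<Longrightarrow> 1 \<le> m \<Longrightarrow> (\<lambda>p. f p - f (- p)) \<in> Pi2 (m - 1)"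
proof -
  have refl: "(\<lambda>p. f (- p)) \<in> Pi2 m"
    using Pi2_subst[of "\<lambda>p. - fst p" 1 "\<lambda>p. - snd p" f m] Pi2_scale[OF Pi2_fst[of 1], of "-1"]
      Pi2_scale[OF Pi2_snd[of 1], of "-1"] assms by (simp add: uminus_prod_def)
  show "(\<lambda>p. f p + f (- p)) \<in> Pi2 m" by (rule Pi2_add[OF assms refl])
  show "(\<lambda>p. f p - f (- p)) \<in> Pi2 (m - 1)" if "even m" "1 \<le> m"
    using assms unfolding Pi2_eq_bipoly
  proof (induction rule: bipoly.induct)
    case zero
    show ?case using bipoly.zero by simp
  next
    case (monom i j c)
    have s: "c * fst p ^ i * snd p ^ j - c * fst (- p) ^ i * snd (- p) ^ j =
        (c * (1 - (-1) ^ (i + j))) * fst p ^ i * snd p ^ j" for p :: "real \<times> real"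
      by (simp add: power_minus[of "fst p"] power_minus[of "snd p"] power_add algebra_simps)
    show ?case
    proof (cases "even (i + j)")
      case True
      then show ?thesis unfolding s using bipoly.zero by simp
    next
      case False
      then have "i + j \<noteq> m" using \<open>even m\<close> by auto
      then have "i + j \<le> m - 1" using monom by auto
      then show ?thesis unfolding s by (intro bipoly.monom) auto
    qed
  next
    case (add f g)
    then show ?case using bipoly.add[OF add.IH] by (simp add: algebra_simps)
  qed
qed

lemma Pi2_eq_0_on_rectangle:
  assumes "f \<in> Pi2 m" "infinite A" "infinite B"
    and "\<And>x y. x \<in> A \<Longrightarrow> y \<in> B \<Longrightarrow> f (x, y) = 0"
  shows "f p = 0"
  using bipoly_eq_0_on_rectangle[OF assms(1)[unfolded Pi2_eq_bipoly] assms(2,3), of "fst p" "snd p"]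
    assms(4) by simp

text \<open>\<open>T\<close> is the difference quotient in the second variable, taken monomial by
  monomial, which lowers the degree by one.\<close>

lemma Pi2_divide_snd:
  assumes "f \<in> Pi2 (Suc m)"
  shows "\<exists>T \<in> Pi2 m. \<forall>x y. f (x, y) = f (x, 0) + y * T (x, y)"
  using assms unfolding Pi2_eq_bipoly
proof (induction rule: bipoly.induct)
  case zero
  show ?case by (rule bexI[OF _ bipoly.zero]) simp
next
  case (monom i j c)
  show ?case
  proof (cases j)
    case 0
    then show ?thesis by (intro bexI[OF _ bipoly.zero]) simp
  next
    case (Suc k)
    then show ?thesis using monom
      by (intro bexI[of _ "\<lambda>p. c * fst p ^ i * snd p ^ k"] bipoly.monom) auto
  qed
next
  case (add f g)
  then obtain S T where "S \<in> bipoly (tri m)" "T \<in> bipoly (tri m)"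
    and ST: "\<And>x y. f (x, y) = f (x, 0) + y * S (x, y)" "\<And>x y. g (x, y) = g (x, 0) + y * T (x, y)"
    by blast
  show ?case
  proof (intro bexI[of _ "\<lambda>p. S p + T p"] allI)
    show "f (x, y) + g (x, y) = f (x, 0) + g (x, 0) + y * (S (x, y) + T (x, y))" for x y
      using ST(1)[of x y] ST(2)[of x y] by (simp add: algebra_simps)
    show "(\<lambda>p. S p + T p) \<in> bipoly (tri m)" by (rule bipoly.add) fact+
  qed
qed

text \<open>The functional \<open>L\<close> enters only through exactness, central symmetry and
  definiteness. The node weights may have any sign, so positivity is drawn from squares under
  \<open>L\<close> and never from the sum over the nodes.\<close>

lemma moeller_bound:
  fixes L :: "(real \<times> real \<Rightarrow> real) \<Rightarrow> real" and Y :: "(real \<times> real) set"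
  assumes n: "1 \<le> n" and fin: "finite Y"
    and cub: "\<And>f. f \<in> Pi2 (4 * n - 1) \<Longrightarrow> L f = (\<Sum>p\<in>Y. \<omega> p * f p)"
    and odd: "\<And>f. f \<in> Pi2 (4 * n - 1) \<Longrightarrow> (\<And>p. f (- p) = - f p) \<Longrightarrow> L f = 0"
    and definite: "\<And>f p. f \<in> Pi2 (2 * n - 1) \<Longrightarrow> L (\<lambda>p. f p * f p) = 0 \<Longrightarrow> f p = 0"
  shows "2 * n * (n + 1) \<le> card Y"
proof (rule ccontr)
  assume "\<not> 2 * n * (n + 1) \<le> card Y"
  then have c: "2 * card Y < (2 * n) * (2 * n + 2)" by simp
  have "1 \<le> 2 * n" using n by simp
  then obtain h P' Q' where deg: "h \<in> Pi2 (2 * n - 1)" "P' \<in> Pi2 (2 * n - 1)" "Q' \<in> Pi2 (2 * n - 1)"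
    and v: "\<forall>p\<in>Y. snd p * h p + P' p = 0" "\<forall>p\<in>Y. - fst p * h p + Q' p = 0"
    and nontriv: "\<not> ((\<forall>p. snd p * h p + P' p = 0) \<and> (\<forall>p. - fst p * h p + Q' p = 0))"
    by (rule syzygy_vanishing_on[OF fin c])
  note Pv' = v(1)[rule_format] and Qv' = v(2)[rule_format]
  have vanish: "f p = 0" if f: "f \<in> Pi2 (2 * n - 1)" and v: "\<And>p. p \<in> Y \<Longrightarrow> f p = 0" for f p
  proof (rule definite[OF f])
    have "(\<lambda>p. f p * f p) \<in> Pi2 (4 * n - 1)" using Pi2_mono[OF Pi2_mult[OF f f]] by simp
    then show "L (\<lambda>p. f p * f p) = 0" using v by (simp add: cub)
  qed
  \<comment> \<open>With \<open>f = (e + o') / 2\<close> and \<open>f = 0\<close> on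
    \<open>Y\<close>, one has \<open>e = - o'\<close> at the nodes. The odd product
    \<open>e * o'\<close> has degree at most \<open>4 * n - 1\<close>, so its node sum is 0, and
    hence so is that of \<open>o' * o'\<close>. Definiteness then kills \<open>o'\<close>.\<close>
  have even: "f (- p) = f p" if f: "f \<in> Pi2 (2 * n)" and v: "\<And>p. p \<in> Y \<Longrightarrow> f p = 0" for f p
  proof -
    define e o' where "e = (\<lambda>p. f p + f (- p))" and "o' = (\<lambda>p. f p - f (- p))"
    have e: "e \<in> Pi2 (2 * n)" and o: "o' \<in> Pi2 (2 * n - 1)"
      using Pi2_reflect_parts[OF f] n by (auto simp: e_def o'_def)
    have eo: "(\<lambda>p. e p * o' p) \<in> Pi2 (4 * n - 1)"
      using Pi2_mono[OF Pi2_mult[OF e o]] n by simp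
    have oo: "(\<lambda>p. o' p * o' p) \<in> Pi2 (4 * n - 1)"
      using Pi2_mono[OF Pi2_mult[OF o o]] n by simp
    have "(\<Sum>p\<in>Y. \<omega> p * (e p * o' p)) = 0"
      unfolding cub[OF eo, symmetric] by (rule odd[OF eo]) (simp add: e_def o'_def algebra_simps)
    moreover have "\<omega> p * (o' p * o' p) = - (\<omega> p * (e p * o' p))" if "p \<in> Y" for p
      using v[OF that] by (simp add: e_def o'_def)
    ultimately have "L (\<lambda>p. o' p * o' p) = 0"
      by (simp add: cub[OF oo] sum_negf)
    then have "o' p = 0" by (rule definite[OF o])
    then show ?thesis by (simp add: o'_def)
  qed
  define P where "P = (\<lambda>p. snd p * h p + P' p)"
  define Q where "Q = (\<lambda>p. - fst p * h p + Q' p)"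
  have one: "Suc (2 * n - 1) = 2 * n" using n by simp
  have fstm: "(\<lambda>p. fst p * f p) \<in> Pi2 (2 * n)" and sndm: "(\<lambda>p. snd p * f p) \<in> Pi2 (2 * n)"
    if "f \<in> Pi2 (2 * n - 1)" for f
    using Pi2_mult[OF Pi2_fst[of 1] that] Pi2_mult[OF Pi2_snd[of 1] that] one by auto
  have P: "P \<in> Pi2 (2 * n)"
    unfolding P_def using Pi2_mono[OF deg(2)] by (intro Pi2_add sndm deg) simp
  have Q: "Q \<in> Pi2 (2 * n)"
    unfolding Q_def using Pi2_add[OF Pi2_scale[OF fstm[OF deg(1)], of "-1"] Pi2_mono[OF deg(3)]] by simp
  have Pe: "P (- p) = P p" and Qe: "Q (- p) = Q p" for p
    using even[OF P] even[OF Q] Pv' Qv' by (auto simp: P_def Q_def)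
  have R0: "fst p * P p + snd p * Q p = 0" for p
  proof -
    define R where "R = (\<lambda>p. fst p * P p + snd p * Q p)"
    \<comment> \<open>The terms \<open>x * y * h\<close> cancel, so no part of degree
      \<open>2 * n + 1\<close> survives; oddness then removes degree \<open>2 * n\<close>.\<close>
    have R_alt: "R = (\<lambda>p. fst p * P' p + snd p * Q' p)"
      by (auto simp: R_def P_def Q_def algebra_simps)
    have "R \<in> Pi2 (2 * n)" unfolding R_alt by (intro Pi2_add fstm sndm deg)
    then have "(\<lambda>p. R p - R (- p)) \<in> Pi2 (2 * n - 1)" by (rule Pi2_reflect_parts) (use n in auto)
    moreover have "R (- p) = - R p" for p by (simp add: R_def Pe Qe)
    ultimately have "(\<lambda>p. 2 * R p) \<in> Pi2 (2 * n - 1)" by simp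
    then have "2 * R p = 0"
      by (rule vanish) (use Pv' Qv' in \<open>auto simp: R_def P_def Q_def\<close>)
    then show ?thesis by (simp add: R_def)
  qed
  have inf: "infinite (UNIV - {0 :: real})" "infinite (UNIV :: real set)"
    by (simp_all add: infinite_UNIV_char_0)
  obtain T where T: "T \<in> Pi2 (2 * n - 1)" and PT: "\<And>x y. P (x, y) = P (x, 0) + y * T (x, y)"
    using Pi2_divide_snd[of P "2 * n - 1"] P one by auto
  \<comment> \<open>At \<open>y = 0\<close> the relation reads \<open>x * P (x, 0) = 0\<close>, so
    \<open>P (x, 0)\<close> vanishes off \<open>x = 0\<close> and therefore everywhere.\<close>
  have P0: "P (x, 0) = 0" for x
  proof -
    have z: "(\<lambda>p. P (fst p, 0)) \<in> Pi2 (2 * n)"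
      using Pi2_subst[OF Pi2_fst[of 1] Pi2_const[of 0 1] P] by simp
    have 0: "P (fst (a, b), 0) = 0" if "a \<in> UNIV - {0}" for a b :: real
      using R0[of "(a, 0)"] that by simp
    have "P (fst (x, 0 :: real), 0) = 0"
      by (rule Pi2_eq_0_on_rectangle[OF z inf 0])
    then show ?thesis by simp
  qed
  then have PT': "P p = snd p * T p" for p using PT[of "fst p" "snd p"] by simp
  have QT: "Q p + fst p * T p = 0" for p
  proof -
    have "(\<lambda>p. Q p + fst p * T p) \<in> Pi2 (2 * n)" by (intro Pi2_add Q fstm T)
    then show ?thesis
    proof (rule Pi2_eq_0_on_rectangle[OF _ inf(2) inf(1)])
      fix x y :: real assume "y \<in> UNIV - {0}"
      moreover have "y * (Q (x, y) + x * T (x, y)) = 0"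
        using R0[of "(x, y)"] by (simp add: PT' algebra_simps)
      ultimately show "Q (x, y) + fst (x, y) * T (x, y) = 0" by simp
    qed
  qed
  \<comment> \<open>At a node both \<open>x * T\<close> and \<open>y * T\<close> vanish, which says
    nothing if the node is the origin. There \<open>T\<close> vanishes because it is odd,
    \<open>y * T = P\<close> being even.\<close>
  have T00: "T (0, 0) = 0"
  proof -
    have "T (0, 0) + T (- (0, 0)) = 0"
      using Pi2_reflect_parts(1)[OF T]
    proof (rule Pi2_eq_0_on_rectangle[OF _ inf(2) inf(1)])
      fix x y :: real assume "y \<in> UNIV - {0}"
      moreover have "y * (T (x, y) + T (- (x, y))) = 0"
        using Pe[of "(x, y)"] PT'[of "(x, y)"] PT'[of "- (x, y)"] by (simp add: algebra_simps)
      ultimately show "T (x, y) + T (- (x, y)) = 0" by simp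
    qed
    then show ?thesis by (simp flip: zero_prod_def)
  qed
  have T0: "T p = 0" for p
  proof (rule vanish[OF T])
    fix p assume "p \<in> Y"
    then have "snd p * T p = 0" "fst p * T p = 0"
      using Pv'[of p] Qv'[of p] PT'[of p] QT[of p] by (auto simp: P_def Q_def)
    then show "T p = 0" using T00 by (cases p) auto
  qed
  have "P p = 0" "Q p = 0" for p
    using PT'[of p] QT[of p] by (simp_all add: T0)
  then show False using nontriv unfolding P_def Q_def by blast
qed

section \<open>Symmetrization and growth of polynomials\<close>

text \<open>In the coordinates \<open>s = x + y\<close>, \<open>d = x - y\<close> the four
  substitutions are the sign changes of \<open>s\<close> and \<open>d\<close>, so only monomials
  even in both survive. With \<open>u = 2 * x * y\<close> and
  \<open>v = x\<^sup>2 + y\<^sup>2 - 1\<close> one has \<open>s\<^sup>2 = v + u + 1\<close> and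
  \<open>d\<^sup>2 = v - u + 1\<close>, which halves the degree.\<close>

lemma Pi2_symmetrize:
  assumes "f \<in> Pi2 m"
  shows "\<exists>A \<in> Pi2 (m div 2). \<forall>x y. f (x, y) + f (y, x) + f (-x, -y) + f (-y, -x) = A (2 * x * y, x\<^sup>2 + y\<^sup>2 - 1)"
proof -
  define g where "g = (\<lambda>p. f ((fst p + snd p) / 2, (fst p - snd p) / 2))"
  have "g \<in> Pi2 (m * 1)" unfolding g_def
  proof (rule Pi2_subst[OF _ _ assms])
    show "(\<lambda>p. (fst p + snd p) / 2) \<in> Pi2 1"
      using Pi2_add[OF Pi2_monom[of 1 0 1 "1/2"] Pi2_monom[of 0 1 1 "1/2"]] by (simp add: add_divide_distrib)
    show "(\<lambda>p. (fst p - snd p) / 2) \<in> Pi2 1"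
      using Pi2_add[OF Pi2_monom[of 1 0 1 "1/2"] Pi2_monom[of 0 1 1 "-1/2"]] by (simp add: diff_divide_distrib)
  qed
  then have "g \<in> bipoly (tri m)" by (simp add: Pi2_eq_bipoly)
  then have "\<exists>A \<in> Pi2 (m div 2). \<forall>x y. g (x + y, x - y) + g (x + y, - (x - y)) +
      g (- (x + y), - (x - y)) + g (- (x + y), x - y) = A (2 * x * y, x\<^sup>2 + y\<^sup>2 - 1)"
  proof (induction rule: bipoly.induct)
    case zero
    show ?case by (rule bexI[OF _ Pi2_const[of 0]]) simp
  next
    case (monom i j c)
    show ?case
    proof (cases "even i \<and> even j")
      case True
      then obtain k l where kl: "i = 2 * k" "j = 2 * l" by (auto elim!: evenE)
      \<comment> \<open>The factor 4 counts the equal contributions of the four sign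
        changes.\<close>
      define A where "A = (\<lambda>p. 4 * c * ((fst p + snd p + 1) ^ k * (snd p - fst p + 1) ^ l) :: real)"
      have 1: "(\<lambda>p. fst p + snd p + 1) \<in> Pi2 1" "(\<lambda>p. snd p - fst p + 1) \<in> Pi2 1"
        using Pi2_add[OF Pi2_add[OF Pi2_fst[of 1] Pi2_snd[of 1]] Pi2_const[of 1 1]]
          Pi2_add[OF Pi2_add[OF Pi2_snd[of 1] Pi2_scale[OF Pi2_fst[of 1], of "-1"]] Pi2_const[of 1 1]] by simp_all
      have "A \<in> Pi2 (k + l)" unfolding A_def
        using Pi2_scale[OF Pi2_subst[OF 1 Pi2_monom[of k l "k + l" 1]], of "4 * c"] by simp
      moreover have "k + l \<le> m div 2" using monom kl by auto
      ultimately have "A \<in> Pi2 (m div 2)" by (rule Pi2_mono)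
      moreover have "A (2 * x * y, x\<^sup>2 + y\<^sup>2 - 1) = 4 * c * ((x + y) ^ i * (x - y) ^ j)" for x y
      proof -
        have "2 * x * y + (x\<^sup>2 + y\<^sup>2 - 1) + 1 = (x + y)\<^sup>2" "x\<^sup>2 + y\<^sup>2 - 1 - 2 * x * y + 1 = (x - y)\<^sup>2"
          by (simp_all add: power2_eq_square algebra_simps)
        then show ?thesis by (simp add: A_def kl power_mult)
      qed
      ultimately show ?thesis
        using True by (intro bexI[of _ A]) (auto simp: power_minus_even simp del: minus_diff_eq minus_add_distrib)
    next
      case False
      have "c * s ^ i * d ^ j + c * s ^ i * (- d) ^ j + c * (- s) ^ i * (- d) ^ j + c * (- s) ^ i * d ^ j = 0"
        for s d :: real
        using False by (cases "even i"; cases "even j") (auto simp: power_minus_odd)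
      then show ?thesis by (intro bexI[OF _ Pi2_const[of 0]]) (simp del: minus_diff_eq minus_add_distrib)
    qed
  next
    case (add f g)
    then obtain A B where "A \<in> Pi2 (m div 2)" "B \<in> Pi2 (m div 2)"
      and AB: "\<And>x y. f (x + y, x - y) + f (x + y, - (x - y)) +
      f (- (x + y), - (x - y)) + f (- (x + y), x - y) = A (2 * x * y, x\<^sup>2 + y\<^sup>2 - 1)"
      "\<And>x y. g (x + y, x - y) + g (x + y, - (x - y)) +
      g (- (x + y), - (x - y)) + g (- (x + y), x - y) = B (2 * x * y, x\<^sup>2 + y\<^sup>2 - 1)"
      by blast
    show ?case
      by (rule bexI[OF _ Pi2_add[OF \<open>A \<in> _\<close> \<open>B \<in> _\<close>]]) (auto simp flip: AB)
  qed
  then show ?thesis by (simp add: g_def algebra_simps)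
qed

text \<open>Newton's recursion: the power sum of exponent \<open>e + 2\<close> is
  \<open>x + y\<close> times that of exponent \<open>e + 1\<close> minus \<open>x * y\<close> times
  that of exponent \<open>e\<close>.\<close>

lemma power_sum_elementary:
  "\<exists>A \<in> Pi2 d. \<forall>x y. x ^ d + y ^ d = A (x + y, x * y)"
proof (induction d rule: less_induct)
  case (less d)
  consider "d = 0" | "d = 1" | e where "d = Suc (Suc e)" by (metis One_nat_def not0_implies_Suc)
  then show ?case
  proof cases
    case 1
    then show ?thesis by (intro bexI[OF _ Pi2_const[of 2]]) simp
  next
    case 2
    then show ?thesis by (intro bexI[OF _ Pi2_fst]) simp_all
  next
    case 3
    obtain A B where A: "A \<in> Pi2 (Suc e)" "\<And>x y. x ^ Suc e + y ^ Suc e = A (x + y, x * y)"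
      and B: "B \<in> Pi2 e" "\<And>x y. x ^ e + y ^ e = B (x + y, x * y)"
      using less[of "Suc e"] less[of e] 3 by auto
    have "(\<lambda>p. fst p * A p) \<in> Pi2 d" "(\<lambda>p. snd p * B p) \<in> Pi2 d"
      using Pi2_mult[OF Pi2_fst[of 1] A(1)] Pi2_mono[OF Pi2_mult[OF Pi2_snd[of 1] B(1)], of d] 3 by auto
    then have "(\<lambda>p. fst p * A p + (-1) * (snd p * B p)) \<in> Pi2 d"
      by (intro Pi2_add Pi2_scale)
    moreover have "x ^ d + y ^ d = (x + y) * A (x + y, x * y) + (-1) * ((x * y) * B (x + y, x * y))" for x y
      unfolding 3 A(2)[symmetric] B(2)[symmetric] by (simp add: algebra_simps)
    ultimately show ?thesis by (intro bexI[of _ "\<lambda>p. fst p * A p + (-1) * (snd p * B p)"]) auto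
  qed
qed

text \<open>A monomial and its mirror image add up to a power of \<open>x * y\<close> times a power
  sum of the exponent difference, and the two degrees add up to the larger exponent. This is the
  converse of \<open>box_subst_elementary\<close>, without loss of degree.\<close>

lemma box_symmetrize:
  assumes "h \<in> bipoly (box2 m)"
  shows "\<exists>A \<in> Pi2 m. \<forall>x y. h (x, y) + h (y, x) = A (x + y, x * y)"
  using assms
proof (induction rule: bipoly.induct)
  case zero
  show ?case by (rule bexI[OF _ Pi2_const[of 0]]) simp
next
  case (monom i j c)
  have aux: "\<exists>A \<in> Pi2 m. \<forall>x y. x ^ (k + d) * y ^ k + y ^ (k + d) * x ^ k = A (x + y, x * y)"
    if "k + d \<le> m" for k d
  proof -
    obtain A where A: "A \<in> Pi2 d" "\<And>x y. x ^ d + y ^ d = A (x + y, x * y)"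
      using power_sum_elementary by blast
    have "(\<lambda>p. snd p ^ k * A p) \<in> Pi2 m"
      using Pi2_mono[OF Pi2_mult[OF Pi2_monom[of 0 k k 1] A(1)] that] by simp
    moreover have "x ^ (k + d) * y ^ k + y ^ (k + d) * x ^ k = (x * y) ^ k * A (x + y, x * y)" for x y
      unfolding A(2)[symmetric] by (simp add: power_add power_mult_distrib algebra_simps)
    ultimately show ?thesis by (intro bexI[of _ "\<lambda>p. snd p ^ k * A p"]) auto
  qed
  have "\<exists>A \<in> Pi2 m. \<forall>x y. x ^ i * y ^ j + y ^ i * x ^ j = A (x + y, x * y)"
  proof (cases "j \<le> i")
    case True
    then show ?thesis using aux[of j "i - j"] monom by simp
  next
    case False
    then show ?thesis using aux[of i "j - i"] monom by (simp add: mult.commute add.commute)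
  qed
  then obtain A where A: "A \<in> Pi2 m" "\<And>x y. x ^ i * y ^ j + y ^ i * x ^ j = A (x + y, x * y)" by blast
  show ?case
    by (rule bexI[OF _ Pi2_scale[OF A(1), of c]]) (simp flip: A(2) add: algebra_simps)
next
  case (add f g)
  then obtain A B where "A \<in> Pi2 m" "B \<in> Pi2 m"
    and AB: "\<And>x y. f (x, y) + f (y, x) = A (x + y, x * y)" "\<And>x y. g (x, y) + g (y, x) = B (x + y, x * y)"
    by blast
  show ?case
    by (rule bexI[OF _ Pi2_add[OF \<open>A \<in> _\<close> \<open>B \<in> _\<close>]]) (auto simp flip: AB)
qed

text \<open>If \<open>r = x\<^sup>2 + y\<^sup>2\<close> is at least 1, both coordinates are at most
  \<open>r\<close> in absolute value. This majorant is chosen because \<open>r = v + 1\<close> in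
  the coordinates of Omega, so it is pulled back from there.\<close>

lemma Pi2_growth:
  assumes "f \<in> Pi2 m"
  shows "\<exists>C. \<forall>x y. 1 \<le> x\<^sup>2 + y\<^sup>2 \<longrightarrow> \<bar>f (x, y)\<bar> \<le> C * (x\<^sup>2 + y\<^sup>2) ^ m"
  using assms unfolding Pi2_eq_bipoly
proof (induction rule: bipoly.induct)
  case zero
  show ?case by (rule exI[of _ 0]) simp
next
  case (monom i j c)
  have le: "\<bar>a\<bar> \<le> r" if "1 \<le> r" "a\<^sup>2 \<le> r" for a r :: real
  proof (cases "\<bar>a\<bar> \<le> 1")
    case False
    then have "\<bar>a\<bar> \<le> \<bar>a\<bar> * \<bar>a\<bar>" using mult_left_mono[of 1 "\<bar>a\<bar>" "\<bar>a\<bar>"] by simp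
    with that show ?thesis by (simp add: power2_eq_square)
  qed (use that in simp)
  show ?case
  proof (intro exI[of _ "\<bar>c\<bar>"] allI impI)
    fix x y :: real assume r: "1 \<le> x\<^sup>2 + y\<^sup>2"
    have "\<bar>x\<bar> ^ i * \<bar>y\<bar> ^ j \<le> (x\<^sup>2 + y\<^sup>2) ^ i * (x\<^sup>2 + y\<^sup>2) ^ j"
      using le[OF r, of x] le[OF r, of y] by (intro mult_mono power_mono) auto
    also have "\<dots> \<le> (x\<^sup>2 + y\<^sup>2) ^ m"
      unfolding power_add[symmetric] using r monom by (intro power_increasing) auto
    finally show "\<bar>c * fst (x, y) ^ i * snd (x, y) ^ j\<bar> \<le> \<bar>c\<bar> * (x\<^sup>2 + y\<^sup>2) ^ m"
      by (simp add: abs_mult power_abs mult.assoc mult_left_mono)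
  qed
next
  case (add f g)
  then obtain C D where CD: "\<And>x y. 1 \<le> x\<^sup>2 + y\<^sup>2 \<Longrightarrow> \<bar>f (x, y)\<bar> \<le> C * (x\<^sup>2 + y\<^sup>2) ^ m"
    "\<And>x y. 1 \<le> x\<^sup>2 + y\<^sup>2 \<Longrightarrow> \<bar>g (x, y)\<bar> \<le> D * (x\<^sup>2 + y\<^sup>2) ^ m" by blast
  show ?case
  proof (intro exI[of _ "C + D"] allI impI)
    fix x y :: real assume "1 \<le> x\<^sup>2 + y\<^sup>2"
    then show "\<bar>f (x, y) + g (x, y)\<bar> \<le> (C + D) * (x\<^sup>2 + y\<^sup>2) ^ m"
      using CD(1)[of x y] CD(2)[of x y] by (simp add: distrib_right)
  qed
qed

section \<open>Change of variables in the plane\<close>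

text \<open>The plane is carried to \<open>real ^ 2\<close>, where Jacobians are determinants of
  matrices; \<open>pair2\<close> leads back, and both maps preserve Lebesgue measure.\<close>

definition vec2 :: "real \<times> real \<Rightarrow> real ^ 2" where
  "vec2 p = (\<chi> i. if i = 1 then fst p else snd p)"

definition pair2 :: "real ^ 2 \<Rightarrow> real \<times> real" where
  "pair2 v = (v $ 1, v $ 2)"

lemma vec2_nth [simp]: "vec2 p $ 1 = fst p" "vec2 p $ 2 = snd p"
  by (simp_all add: vec2_def)

lemma pair2_vec2 [simp]: "pair2 (vec2 p) = p"
  by (simp add: pair2_def)

lemma vec2_pair2 [simp]: "vec2 (pair2 v) = v"
  by (simp add: pair2_def vec_eq_iff forall_2)

lemma bounded_linear_vec2: "bounded_linear vec2"
  by (rule linear_conv_bounded_linear[THEN iffD1], rule linearI)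
     (simp_all add: vec_eq_iff forall_2)

lemma bounded_linear_pair2: "bounded_linear pair2"
  by (rule linear_conv_bounded_linear[THEN iffD1], rule linearI)
     (simp_all add: pair2_def)

lemma vec2_borel [measurable]: "vec2 \<in> borel \<rightarrow>\<^sub>M borel"
  by (intro borel_measurable_continuous_onI linear_continuous_on bounded_linear_vec2)

lemma pair2_borel [measurable]: "pair2 \<in> borel \<rightarrow>\<^sub>M borel"
  by (intro borel_measurable_continuous_onI linear_continuous_on bounded_linear_pair2)

lemma lborel_distr_vec2: "distr lborel borel vec2 = (lborel :: (real ^ 2) measure)"
proof (rule lborel_eqI[symmetric])
  fix l u :: "real ^ 2"
  assume lu: "\<And>b. b \<in> Basis \<Longrightarrow> l \<bullet> b \<le> u \<bullet> b"
  have "l $ i \<le> u $ i" for i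
    using lu[of "axis i 1"] by (auto simp: Basis_vec_def inner_axis)
  have "emeasure (distr lborel borel vec2) (box l u) = emeasure lborel (vec2 -` box l u)"
    by (subst emeasure_distr) (auto simp: space_borel)
  also have "vec2 -` box l u = {l $ 1<..<u $ 1} \<times> {l $ 2<..<u $ 2}"
    by (auto simp: mem_box_cart forall_2)
  also have "emeasure lborel \<dots> = ennreal (u $ 1 - l $ 1) * ennreal (u $ 2 - l $ 2)"
    using \<open>\<And>i. l $ i \<le> u $ i\<close>
    by (subst lborel_prod[symmetric], subst lborel.emeasure_pair_measure_Times) auto
  also have "\<dots> = ennreal (\<Prod>i\<in>UNIV. (u - l) $ i)"
    using \<open>\<And>i. l $ i \<le> u $ i\<close> by (simp add: UNIV_2 ennreal_mult)
  also have "(\<Prod>i\<in>UNIV. (u - l) $ i) = (\<Prod>b\<in>Basis. (u - l) \<bullet> b)"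
  proof -
    have B: "(Basis :: (real^2) set) = range (\<lambda>i. axis i 1)" by (auto simp: Basis_vec_def)
    show ?thesis unfolding B
      by (subst prod.reindex) (auto simp: inj_on_def axis_eq_axis inner_axis)
  qed
  finally show "emeasure (distr lborel borel vec2) (box l u) = ennreal (\<Prod>b\<in>Basis. (u - l) \<bullet> b)" .
qed simp

lemma lborel_distr_pair2: "distr lborel borel pair2 = (lborel :: (real \<times> real) measure)"
proof -
  have "distr lborel borel pair2 = distr (distr lborel borel vec2) borel pair2"
    by (simp add: lborel_distr_vec2)
  also have "\<dots> = distr lborel borel (pair2 \<circ> vec2)"
    by (rule distr_distr) auto
  also have "\<dots> = lborel"
    by (simp add: o_def distr_id2)
  finally show ?thesis .
qed

text \<open>A measure-preserving Borel map pulls null sets back to null sets, hence stays measurable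
  and measure preserving for the completed measures.\<close>

lemma completion_distr_self:
  fixes T :: "'a::euclidean_space \<Rightarrow> 'b::euclidean_space"
  assumes T: "T \<in> borel \<rightarrow>\<^sub>M borel" and d: "distr lborel borel T = lborel"
  shows "T \<in> lebesgue \<rightarrow>\<^sub>M lebesgue" "distr lebesgue lebesgue T = lebesgue"
proof -
  have 1: "T \<in> lebesgue \<rightarrow>\<^sub>M lborel"
    using T by (simp add: measurable_completion)
  have 2: "distr lebesgue lborel T = lborel"
  proof -
    have "distr lebesgue lborel T = distr lborel lborel T"
      using T by (intro distr_completion) simp
    also have "\<dots> = distr lborel borel T"
      by (rule distr_cong) auto
    finally show ?thesis using d by simp
  qed
  show "T \<in> lebesgue \<rightarrow>\<^sub>M lebesgue"
    by (rule completion.measurable_completion2[OF 1]) (simp add: 2)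
  show "distr lebesgue lebesgue T = lebesgue"
    using completion.completion_distr_eq[OF 1] 2 by simp
qed

lemma integral_vec2:
  fixes f :: "real ^ 2 \<Rightarrow> real"
  shows "integrable lebesgue (\<lambda>p. f (vec2 p)) \<longleftrightarrow> integrable lebesgue f"
    "(\<integral>p. f (vec2 p) \<partial>lebesgue) = (\<integral>v. f v \<partial>lebesgue)"
proof -
  note v = completion_distr_self[OF vec2_borel lborel_distr_vec2]
  note w = completion_distr_self[OF pair2_borel lborel_distr_pair2]
  show iff: "integrable lebesgue (\<lambda>p. f (vec2 p)) \<longleftrightarrow> integrable lebesgue f"
    using integrable_distr[OF v(1), of f] integrable_distr[OF w(1), of "\<lambda>p. f (vec2 p)"]
    by (auto simp: v(2) w(2))
  show "(\<integral>p. f (vec2 p) \<partial>lebesgue) = (\<integral>v. f v \<partial>lebesgue)"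
  proof (cases "integrable lebesgue f")
    case True
    then show ?thesis using integral_distr[OF v(1), of f] by (simp add: v(2))
  next
    case False
    then show ?thesis using iff by (simp add: not_integrable_integral_eq)
  qed
qed

lemma set_integral_vec2:
  fixes f :: "real ^ 2 \<Rightarrow> real"
  shows "set_integrable lebesgue (vec2 ` S) f \<longleftrightarrow> set_integrable lebesgue S (\<lambda>p. f (vec2 p))"
    "(LINT v:vec2 ` S|lebesgue. f v) = (LINT p:S|lebesgue. f (vec2 p))"
proof -
  have *: "vec2 p \<in> vec2 ` S \<longleftrightarrow> p \<in> S" for p
    by (metis imageE image_eqI pair2_vec2)
  have "(\<lambda>p. indicator (vec2 ` S) (vec2 p) *\<^sub>R f (vec2 p)) = (\<lambda>p. indicator S p *\<^sub>R f (vec2 p))"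
    by (auto simp: * indicator_def)
  then show "set_integrable lebesgue (vec2 ` S) f \<longleftrightarrow> set_integrable lebesgue S (\<lambda>p. f (vec2 p))"
    "(LINT v:vec2 ` S|lebesgue. f v) = (LINT p:S|lebesgue. f (vec2 p))"
    unfolding set_integrable_def set_lebesgue_integral_def
    using integral_vec2[of "\<lambda>v. indicator (vec2 ` S) v *\<^sub>R f v"] by simp_all
qed

text \<open>The functions \<open>a\<close>, \<open>b\<close>, \<open>c\<close>, \<open>d\<close> are
  the entries of the Jacobian matrix. Integrability is transferred in both directions, so the
  equation of integrals is not an artefact of the value 0 for non-integrable functions.\<close>

theorem set_integral_change_of_variables_plane:
  fixes f :: "real \<times> real \<Rightarrow> real" and g :: "real \<times> real \<Rightarrow> real \<times> real"
  assumes S: "S \<in> sets lebesgue" and inj: "inj_on g S"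
    and der: "\<And>p. p \<in> S \<Longrightarrow>
      (g has_derivative (\<lambda>h. (a p * fst h + b p * snd h, c p * fst h + d p * snd h))) (at p)"
  shows "set_integrable lebesgue S (\<lambda>p. \<bar>a p * d p - b p * c p\<bar> * f (g p))
      \<longleftrightarrow> set_integrable lebesgue (g ` S) f" (is ?I)
    and "(LINT p:S|lebesgue. \<bar>a p * d p - b p * c p\<bar> * f (g p)) = (LINT q:g ` S|lebesgue. f q)" (is ?E)
proof -
  define F :: "real ^ 2 \<Rightarrow> real ^ 1" where "F = (\<lambda>v. vec (f (pair2 v)))"
  define H where "H = (\<lambda>v. vec2 (g (pair2 v)))"
  define H' where "H' = (\<lambda>v h. let p = pair2 v; k = pair2 h in
    vec2 (a p * fst k + b p * snd k, c p * fst k + d p * snd k))"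
  let ?D = "\<lambda>v. \<bar>a v * d v - b v * c v\<bar> * f (g v)"
  have S': "vec2 ` S \<in> sets lebesgue"
  proof -
    have "vec2 ` S = pair2 -` S \<inter> space lebesgue"
      by (auto intro: image_eqI[of _ _ "pair2 _"])
    then show ?thesis
      using measurable_sets[OF completion_distr_self(1)[OF pair2_borel lborel_distr_pair2] S] by simp
  qed
  have der': "(H has_derivative H' v) (at v within vec2 ` S)" if "v \<in> vec2 ` S" for v
  proof -
    have "pair2 v \<in> S" using that by auto
    have 1: "(pair2 has_derivative pair2) (at v within vec2 ` S)"
      by (rule bounded_linear_imp_has_derivative[OF bounded_linear_pair2])
    have 2: "(vec2 has_derivative vec2) (at p)" for p
      by (rule bounded_linear_imp_has_derivative[OF bounded_linear_vec2])
    have "((\<lambda>v. vec2 (g (pair2 v))) has_derivative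
        (\<lambda>h. vec2 (a (pair2 v) * fst (pair2 h) + b (pair2 v) * snd (pair2 h),
          c (pair2 v) * fst (pair2 h) + d (pair2 v) * snd (pair2 h)))) (at v within vec2 ` S)"
      by (rule has_derivative_compose[OF has_derivative_compose[OF 1 der[OF \<open>pair2 v \<in> S\<close>]] 2])
    then show ?thesis by (simp add: H_def H'_def Let_def)
  qed
  have inj': "inj_on H (vec2 ` S)"
  proof (rule inj_onI)
    fix v v' assume *: "v \<in> vec2 ` S" "v' \<in> vec2 ` S" "H v = H v'"
    have "g (pair2 v) = g (pair2 v')"
      using arg_cong[OF *(3), of pair2] by (simp add: H_def)
    moreover have "pair2 v \<in> S" "pair2 v' \<in> S" using *(1,2) by auto
    ultimately have "pair2 v = pair2 v'" by (rule inj_onD[OF inj])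
    then show "v = v'" by (metis vec2_pair2)
  qed
  have det: "det (matrix (H' v)) = a (pair2 v) * d (pair2 v) - b (pair2 v) * c (pair2 v)" for v
    by (simp add: det_2 matrix_def H'_def Let_def pair2_def axis_def)
  have img: "H ` vec2 ` S = vec2 ` (g ` S)"
    by (auto simp: H_def image_image)
  \<comment> \<open>\<open>r\<close> is arbitrary: choosing it as the value of either integral
    separates the equivalence of integrability from the equality.\<close>
  have main: "((\<lambda>v. ?D (pair2 v)) absolutely_integrable_on vec2 ` S \<and>
        integral (vec2 ` S) (\<lambda>v. ?D (pair2 v)) = r) \<longleftrightarrow>
      (\<lambda>v. f (pair2 v)) absolutely_integrable_on vec2 ` (g ` S) \<and>
        integral (vec2 ` (g ` S)) (\<lambda>v. f (pair2 v)) = r" for r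
    using has_absolute_integral_change_of_variables[OF S' der' inj', of F "vec r"]
    unfolding img F_def absolutely_integrable_on_1_iff integral_on_1_eq
    by (simp add: o_def det H_def)
  then have iff: "set_integrable lebesgue (vec2 ` S) (\<lambda>v. ?D (pair2 v)) \<longleftrightarrow>
      set_integrable lebesgue (vec2 ` (g ` S)) (\<lambda>v. f (pair2 v))"
    by blast
  then show I: ?I
    using set_integral_vec2(1)[of S "\<lambda>v. ?D (pair2 v)"]
      set_integral_vec2(1)[of "g ` S" "\<lambda>v. f (pair2 v)"] by simp
  show ?E
  proof (cases "set_integrable lebesgue (g ` S) f")
    case True
    then have "set_integrable lebesgue (vec2 ` (g ` S)) (\<lambda>v. f (pair2 v))"
      using set_integral_vec2(1)[of "g ` S" "\<lambda>v. f (pair2 v)"] by simp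
    then have "integral (vec2 ` S) (\<lambda>v. ?D (pair2 v)) = integral (vec2 ` (g ` S)) (\<lambda>v. f (pair2 v))"
      "set_integrable lebesgue (vec2 ` (g ` S)) (\<lambda>v. f (pair2 v))"
      "set_integrable lebesgue (vec2 ` S) (\<lambda>v. ?D (pair2 v))"
      using main iff by blast+
    then have "(LINT v:vec2 ` S|lebesgue. ?D (pair2 v)) = (LINT v:vec2 ` (g ` S)|lebesgue. f (pair2 v))"
      by (simp add: set_lebesgue_integral_eq_integral(2))
    then show ?thesis by (simp add: set_integral_vec2(2))
  next
    case False
    \<comment> \<open>Neither side is integrable, so both integrals are 0 by convention.\<close>
    then have "\<not> set_integrable lebesgue S ?D" using I by simp
    with False show ?thesis
      unfolding set_integrable_def set_lebesgue_integral_def by (simp add: not_integrable_integral_eq)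
  qed
qed

section \<open>Integrals against product weights\<close>

lemma null_sets_fst_snd:
  assumes N: "N \<in> null_sets (lborel :: real measure)"
  shows "fst -` N \<in> null_sets (lborel :: (real \<times> real) measure)"
    and "snd -` N \<in> null_sets (lborel :: (real \<times> real) measure)"
proof -
  have [measurable]: "N \<in> sets borel" and e: "emeasure lborel N = 0"
    using N by auto
  have "emeasure (lborel \<Otimes>\<^sub>M lborel) (N \<times> (UNIV :: real set)) = 0"
    "emeasure (lborel \<Otimes>\<^sub>M lborel) ((UNIV :: real set) \<times> N) = 0"
    by (subst lborel.emeasure_pair_measure_Times; simp add: e)+
  moreover have "fst -` N = N \<times> (UNIV :: real set)" "snd -` N = (UNIV :: real set) \<times> N"
    by auto
  moreover have "N \<times> (UNIV :: real set) \<in> sets borel" "(UNIV :: real set) \<times> N \<in> sets borel"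
    by (auto intro: borel_Times)
  ultimately show "fst -` N \<in> null_sets (lborel :: (real \<times> real) measure)"
    and "snd -` N \<in> null_sets (lborel :: (real \<times> real) measure)"
    by (auto simp: null_sets_def lborel_prod)
qed

text \<open>Preimages of null sets are cylinders over null sets, hence null, so measurability passes
  from Borel sets to the completion.\<close>

lemma measurable_fst_snd_lebesgue:
  "fst \<in> (lebesgue :: (real \<times> real) measure) \<rightarrow>\<^sub>M (lebesgue :: real measure)"
  "snd \<in> (lebesgue :: (real \<times> real) measure) \<rightarrow>\<^sub>M (lebesgue :: real measure)"
proof -
  have m: "fst \<in> (lebesgue :: (real \<times> real) measure) \<rightarrow>\<^sub>M (lborel :: real measure)"
    "snd \<in> (lebesgue :: (real \<times> real) measure) \<rightarrow>\<^sub>M (lborel :: real measure)"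
    by (auto intro!: measurable_completion borel_measurable_continuous_onI continuous_intros)
  have "N \<in> null_sets (distr lebesgue lborel (fst :: real \<times> real \<Rightarrow> real))"
    "N \<in> null_sets (distr lebesgue lborel (snd :: real \<times> real \<Rightarrow> real))"
    if N: "N \<in> null_sets lborel" for N
    using N null_sets_fst_snd[OF N] null_sets_completionI m
    by (auto simp: null_sets_def emeasure_distr[OF m(1)] emeasure_distr[OF m(2)])
  then show "fst \<in> (lebesgue :: (real \<times> real) measure) \<rightarrow>\<^sub>M (lebesgue :: real measure)"
    "snd \<in> (lebesgue :: (real \<times> real) measure) \<rightarrow>\<^sub>M (lebesgue :: real measure)"
    by (auto intro!: completion.measurable_completion2 m)
qed

text \<open>Lebesgue measure on the plane is the completion of the Borel product measure, to which
  Fubini applies. \<open>F\<close> and \<open>G\<close> are replaced by Borel functions equal to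
  them almost everywhere; the exceptional sets in the plane are cylinders over null sets.\<close>

lemma integral_product_lebesgue:
  fixes F G :: "real \<Rightarrow> real"
  assumes F: "integrable lebesgue F" and G: "integrable lebesgue G"
  shows "integrable lebesgue (\<lambda>p. F (fst p) * G (snd p))"
    and "(\<integral>p. F (fst p) * G (snd p) \<partial>lebesgue) = (\<integral>x. F x \<partial>lebesgue) * (\<integral>x. G x \<partial>lebesgue)"
proof -
  obtain F' where F'[measurable]: "F' \<in> borel_measurable lborel" and aeF: "AE x in lborel. F x = F' x"
    using completion_ex_borel_measurable_real[of F lborel] F by auto
  obtain G' where G'[measurable]: "G' \<in> borel_measurable lborel" and aeG: "AE x in lborel. G x = G' x"
    using completion_ex_borel_measurable_real[of G lborel] G by auto
  have iF: "integrable lborel F'" "(\<integral>x. F' x \<partial>lborel) = (\<integral>x. F x \<partial>lebesgue)"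
  proof -
    have "integrable lebesgue F'"
      using F by (rule integrable_cong_AE_imp) (auto simp: measurable_completion intro: AE_completion aeF)
    then show "integrable lborel F'" by (simp add: integrable_completion)
    have "(\<integral>x. F x \<partial>lebesgue) = (\<integral>x. F' x \<partial>lebesgue)"
      using F by (intro integral_cong_AE) (auto simp: measurable_completion intro: AE_completion aeF)
    then show "(\<integral>x. F' x \<partial>lborel) = (\<integral>x. F x \<partial>lebesgue)" by (simp add: integral_completion)
  qed
  have iG: "integrable lborel G'" "(\<integral>x. G' x \<partial>lborel) = (\<integral>x. G x \<partial>lebesgue)"
  proof -
    have "integrable lebesgue G'"
      using G by (rule integrable_cong_AE_imp) (auto simp: measurable_completion intro: AE_completion aeG)
    then show "integrable lborel G'" by (simp add: integrable_completion)
    have "(\<integral>x. G x \<partial>lebesgue) = (\<integral>x. G' x \<partial>lebesgue)"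
      using G by (intro integral_cong_AE) (auto simp: measurable_completion intro: AE_completion aeG)
    then show "(\<integral>x. G' x \<partial>lborel) = (\<integral>x. G x \<partial>lebesgue)" by (simp add: integral_completion)
  qed
  have prod: "integrable (lborel \<Otimes>\<^sub>M lborel) (\<lambda>p. F' (fst p) * G' (snd p))"
    by (rule lborel_pair.Fubini_integrable) (auto simp: abs_mult iF(1) iG(1) integrable_abs)
  have val: "(\<integral>p. F' (fst p) * G' (snd p) \<partial>(lborel \<Otimes>\<^sub>M lborel)) = (\<integral>x. F x \<partial>lebesgue) * (\<integral>x. G x \<partial>lebesgue)"
    by (subst lborel_pair.integral_fst'[symmetric, OF prod]) (simp add: iF iG)
  have m': "(\<lambda>p. F' (fst p) * G' (snd p)) \<in> borel_measurable (lborel :: (real \<times> real) measure)"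
    using borel_measurable_integrable[OF prod] by (simp add: lborel_prod)
  have prod': "integrable lebesgue (\<lambda>p. F' (fst p) * G' (snd p))"
    using prod m' by (simp add: integrable_completion lborel_prod)
  have val': "(\<integral>p. F' (fst p) * G' (snd p) \<partial>lebesgue) = (\<integral>x. F x \<partial>lebesgue) * (\<integral>x. G x \<partial>lebesgue)"
    using val m' by (simp add: integral_completion lborel_prod)
  have AE1: "AE p in (lborel :: (real \<times> real) measure). H (fst p) = H' (fst p)"
    and AE2: "AE p in (lborel :: (real \<times> real) measure). H (snd p) = H' (snd p)"
    if ae: "AE x in lborel. H x = H' x" for H H' :: "real \<Rightarrow> real"
  proof -
    obtain N where N: "N \<in> null_sets lborel" "{x \<in> space lborel. H x \<noteq> H' x} \<subseteq> N"
      using ae unfolding eventually_ae_filter by blast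
    have 1: "{p \<in> space lborel. H (fst p) \<noteq> H' (fst p)} \<subseteq> fst -` N"
      and 2: "{p \<in> space lborel. H (snd p) \<noteq> H' (snd p)} \<subseteq> snd -` N"
      using N(2) by force+
    show "AE p in (lborel :: (real \<times> real) measure). H (fst p) = H' (fst p)"
      by (rule AE_I'[OF null_sets_fst_snd(1)[OF N(1)] 1])
    show "AE p in (lborel :: (real \<times> real) measure). H (snd p) = H' (snd p)"
      by (rule AE_I'[OF null_sets_fst_snd(2)[OF N(1)] 2])
  qed
  have "AE p in (lborel :: (real \<times> real) measure). F (fst p) * G (snd p) = F' (fst p) * G' (snd p)"
    using AE1[OF aeF] AE2[OF aeG] by eventually_elim simp
  then have ae: "AE p in (lebesgue :: (real \<times> real) measure). F (fst p) * G (snd p) = F' (fst p) * G' (snd p)"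
    by (rule AE_completion)
  have m: "(\<lambda>p. F (fst p) * G (snd p)) \<in> borel_measurable (lebesgue :: (real \<times> real) measure)"
    by (intro borel_measurable_times measurable_compose[OF measurable_fst_snd_lebesgue(1)]
      measurable_compose[OF measurable_fst_snd_lebesgue(2)] borel_measurable_integrable F G)
  show "integrable lebesgue (\<lambda>p. F (fst p) * G (snd p))"
    using integrable_cong_AE[OF m borel_measurable_integrable[OF prod'] ae] prod' by simp
  show "(\<integral>p. F (fst p) * G (snd p) \<partial>lebesgue) = (\<integral>x. F x \<partial>lebesgue) * (\<integral>x. G x \<partial>lebesgue)"
    using integral_cong_AE[OF m borel_measurable_integrable[OF prod'] ae] val' by simp
qed

lemma set_integral_product_lebesgue:
  fixes F G :: "real \<Rightarrow> real"
  assumes F: "set_integrable lebesgue A F" and G: "set_integrable lebesgue B G"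
  shows "set_integrable lebesgue (A \<times> B) (\<lambda>p. F (fst p) * G (snd p))"
    and "(LINT p:A \<times> B|lebesgue. F (fst p) * G (snd p)) = (LINT x:A|lebesgue. F x) * (LINT x:B|lebesgue. G x)"
proof -
  have *: "(\<lambda>p. indicator (A \<times> B) p *\<^sub>R (F (fst p) * G (snd p))) =
    (\<lambda>p. (indicator A (fst p) *\<^sub>R F (fst p)) * (indicator B (snd p) *\<^sub>R G (snd p)))"
    by (auto simp: indicator_def)
  show "set_integrable lebesgue (A \<times> B) (\<lambda>p. F (fst p) * G (snd p))"
    and "(LINT p:A \<times> B|lebesgue. F (fst p) * G (snd p)) = (LINT x:A|lebesgue. F x) * (LINT x:B|lebesgue. G x)"
    unfolding set_integrable_def set_lebesgue_integral_def *
    using integral_product_lebesgue[OF F[unfolded set_integrable_def] G[unfolded set_integrable_def]] by auto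
qed

section \<open>Moments and definiteness of the product weight\<close>

lemma weight_poly_integrable:
  assumes w: "weight_fun w"
  shows "set_integrable lebesgue {1..} (\<lambda>t. poly q t * w t)"
proof -
  have "set_integrable lebesgue {1..} (\<lambda>t. coeff q i * (t ^ i * w t))" for i
    by (rule set_integrable_mult_right) (use w in \<open>simp add: weight_fun_def\<close>)
  then have "set_integrable lebesgue {1..} (\<lambda>t. \<Sum>i\<le>degree q. coeff q i * (t ^ i * w t))"
    unfolding set_integrable_def scaleR_sum_right
    by (intro Bochner_Integration.integrable_sum)
  then show ?thesis
    by (simp add: poly_altdef sum_distrib_right mult.assoc)
qed

lemma weight_integral_linear:
  assumes w: "weight_fun w"
  shows "(LINT t:{1..}|lebesgue. poly (p + q) t * w t) =
      (LINT t:{1..}|lebesgue. poly p t * w t) + (LINT t:{1..}|lebesgue. poly q t * w t)"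
    and "(LINT t:{1..}|lebesgue. poly (smult c q) t * w t) = c * (LINT t:{1..}|lebesgue. poly q t * w t)"
proof -
  show "(LINT t:{1..}|lebesgue. poly (p + q) t * w t) =
      (LINT t:{1..}|lebesgue. poly p t * w t) + (LINT t:{1..}|lebesgue. poly q t * w t)"
    using set_integral_add(2)[OF weight_poly_integrable[OF w, of p] weight_poly_integrable[OF w, of q]]
    by (simp add: distrib_right)
  show "(LINT t:{1..}|lebesgue. poly (smult c q) t * w t) = c * (LINT t:{1..}|lebesgue. poly q t * w t)"
    by (simp add: mult.assoc)
qed

text \<open>A nonnegative integrand with integral 0 vanishes almost everywhere. A nonzero
  \<open>q\<close> has only finitely many zeros, which would force \<open>w = 0\<close> almost
  everywhere on the half-line, against its positive mass.\<close>

lemma weight_integral_definite: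
  assumes w: "weight_fun w" and nn: "\<And>t. 1 \<le> t \<Longrightarrow> 0 \<le> poly q t"
    and z: "(LINT t:{1..}|lebesgue. poly q t * w t) = 0"
  shows "q = 0"
proof (rule ccontr)
  assume "q \<noteq> 0"
  have int: "integrable lebesgue (\<lambda>t. indicator {1..} t *\<^sub>R (poly q t * w t))"
    using weight_poly_integrable[OF w, of q] by (simp add: set_integrable_def)
  have w0: "0 \<le> w t" if "1 \<le> t" for t using w that by (simp add: weight_fun_def)
  have "AE t in lebesgue. indicator {1..} t *\<^sub>R (poly q t * w t) = 0"
    using z integral_nonneg_eq_0_iff_AE[OF int] nn w0
    by (auto simp: set_lebesgue_integral_def indicator_def)
  moreover have "AE t in lebesgue. poly q t \<noteq> 0"
    using poly_roots_finite[OF \<open>q \<noteq> 0\<close>]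
    by (intro AE_I'[of "{t. poly q t = 0}"]) (auto intro: null_sets_completionI finite_imp_null_set_lborel)
  ultimately have "AE t in lebesgue. indicator {1..} t *\<^sub>R w t = 0"
    by eventually_elim auto
  then have "(LINT t:{1..}|lebesgue. w t) = 0"
    unfolding set_lebesgue_integral_def by (rule integral_eq_zero_AE)
  then show False using w by (simp add: weight_fun_def)
qed

context
  fixes w :: "real \<Rightarrow> real"
  assumes w: "weight_fun w"
begin

lemma weight2_monom:
  "set_integrable lebesgue ({1..} \<times> {1..}) (\<lambda>p. c * fst p ^ i * snd p ^ j * (w (fst p) * w (snd p)))"
  "(LINT p:{1..} \<times> {1..}|lebesgue. c * fst p ^ i * snd p ^ j * (w (fst p) * w (snd p))) =
     c * (LINT t:{1..}|lebesgue. t ^ i * w t) * (LINT t:{1..}|lebesgue. t ^ j * w t)"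
proof -
  have m: "set_integrable lebesgue {1..} (\<lambda>t. t ^ k * w t)" for k
    using w by (simp add: weight_fun_def)
  have *: "(\<lambda>p. c * fst p ^ i * snd p ^ j * (w (fst p) * w (snd p))) =
    (\<lambda>p. c * ((fst p ^ i * w (fst p)) * (snd p ^ j * w (snd p))))"
    by (auto simp: mult_ac)
  show "set_integrable lebesgue ({1..} \<times> {1..}) (\<lambda>p. c * fst p ^ i * snd p ^ j * (w (fst p) * w (snd p)))"
    unfolding * by (rule set_integrable_mult_right) (rule set_integral_product_lebesgue[OF m m])
  show "(LINT p:{1..} \<times> {1..}|lebesgue. c * fst p ^ i * snd p ^ j * (w (fst p) * w (snd p))) =
     c * (LINT t:{1..}|lebesgue. t ^ i * w t) * (LINT t:{1..}|lebesgue. t ^ j * w t)"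
    unfolding * by (simp add: set_integral_product_lebesgue(2)[OF m m])
qed

lemma weight2_integrable:
  "f \<in> bipoly K \<Longrightarrow> set_integrable lebesgue ({1..} \<times> {1..}) (\<lambda>p. f p * (w (fst p) * w (snd p)))"
proof (induction rule: bipoly.induct)
  case zero
  show ?case by (simp add: set_integrable_def)
next
  case (monom i j c)
  show ?case by (rule weight2_monom)
next
  case (add f g)
  then show ?case using set_integral_add(1)[OF add.IH] by (simp add: distrib_right)
qed

lemma weight2_integral_add:
  assumes "f \<in> bipoly K" "g \<in> bipoly K"
  shows "(LINT p:{1..} \<times> {1..}|lebesgue. (f p + g p) * (w (fst p) * w (snd p))) =
    (LINT p:{1..} \<times> {1..}|lebesgue. f p * (w (fst p) * w (snd p))) +
    (LINT p:{1..} \<times> {1..}|lebesgue. g p * (w (fst p) * w (snd p)))"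
  using set_integral_add(2)[OF weight2_integrable[OF assms(1)] weight2_integrable[OF assms(2)]]
  by (simp add: distrib_right)

text \<open>Integrating out \<open>y\<close> leaves a polynomial in \<open>x\<close>, to which the
  one-variable definiteness applies. On monomials the double integral is a product of moments, so
  the iterated form follows by linearity.\<close>

lemma weight2_iterated:
  assumes "f \<in> bipoly K"
  shows "\<exists>q. (\<forall>x. (LINT y:{1..}|lebesgue. f (x, y) * w y) = poly q x) \<and>
    (LINT p:{1..} \<times> {1..}|lebesgue. f p * (w (fst p) * w (snd p))) = (LINT x:{1..}|lebesgue. poly q x * w x)"
  using assms
proof (induction rule: bipoly.induct)
  case zero
  show ?case by (intro exI[of _ 0]) (simp add: set_lebesgue_integral_def)
next
  case (monom i j c)
  show ?case
  proof (intro exI[of _ "Polynomial.monom (c * (LINT t:{1..}|lebesgue. t ^ j * w t)) i"] conjI allI)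
    show "(LINT y:{1..}|lebesgue. c * fst (x, y) ^ i * snd (x, y) ^ j * w y) =
      poly (Polynomial.monom (c * (LINT t:{1..}|lebesgue. t ^ j * w t)) i) x" for x
    proof -
      have "(LINT y:{1..}|lebesgue. c * fst (x, y) ^ i * snd (x, y) ^ j * w y) =
        (LINT y:{1..}|lebesgue. (c * x ^ i) * (y ^ j * w y))" by (simp add: mult.assoc)
      also have "\<dots> = (c * x ^ i) * (LINT y:{1..}|lebesgue. y ^ j * w y)"
        by (rule set_integral_mult_right)
      finally show ?thesis by (simp add: poly_monom)
    qed
    have "(LINT x:{1..}|lebesgue. poly (Polynomial.monom (c * (LINT t:{1..}|lebesgue. t ^ j * w t)) i) x * w x) =
      (LINT x:{1..}|lebesgue. (c * (LINT t:{1..}|lebesgue. t ^ j * w t)) * (x ^ i * w x))"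
      by (simp add: poly_monom mult.assoc)
    also have "\<dots> = (c * (LINT t:{1..}|lebesgue. t ^ j * w t)) * (LINT x:{1..}|lebesgue. x ^ i * w x)"
      by (rule set_integral_mult_right)
    finally show "(LINT p:{1..} \<times> {1..}|lebesgue. c * fst p ^ i * snd p ^ j * (w (fst p) * w (snd p))) =
      (LINT x:{1..}|lebesgue. poly (Polynomial.monom (c * (LINT t:{1..}|lebesgue. t ^ j * w t)) i) x * w x)"
      by (simp add: weight2_monom(2))
  qed
next
  case (add f g)
  then obtain q r where q: "\<And>x. (LINT y:{1..}|lebesgue. f (x, y) * w y) = poly q x"
      "(LINT p:{1..} \<times> {1..}|lebesgue. f p * (w (fst p) * w (snd p))) = (LINT x:{1..}|lebesgue. poly q x * w x)"
    and r: "\<And>x. (LINT y:{1..}|lebesgue. g (x, y) * w y) = poly r x"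
      "(LINT p:{1..} \<times> {1..}|lebesgue. g p * (w (fst p) * w (snd p))) = (LINT x:{1..}|lebesgue. poly r x * w x)"
    by blast
  show ?case
  proof (intro exI[of _ "q + r"] conjI allI)
    show "(LINT y:{1..}|lebesgue. (f (x, y) + g (x, y)) * w y) = poly (q + r) x" for x
    proof -
      obtain s t where s: "\<And>y. f (x, y) = poly s y" and t: "\<And>y. g (x, y) = poly t y"
        using bipoly_section(1) add.hyps by metis
      show ?thesis
        using weight_integral_linear(1)[OF w, of s t] q(1)[of x] r(1)[of x] by (simp add: s t)
    qed
    show "(LINT p:{1..} \<times> {1..}|lebesgue. (f p + g p) * (w (fst p) * w (snd p))) =
      (LINT x:{1..}|lebesgue. poly (q + r) x * w x)"
      using weight2_integral_add[OF add.hyps] q(2) r(2) weight_integral_linear(1)[OF w, of q r] by simp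
  qed
qed

text \<open>One-variable definiteness is used twice: on the polynomial left after integrating out
  \<open>y\<close>, then on the section at \<open>x\<close>, which is nonnegative because
  \<open>1 \<le> x\<close>. That section is the zero polynomial, so \<open>y\<close> is
  arbitrary.\<close>

lemma weight2_integral_definite:
  assumes f: "f \<in> bipoly K" and nn: "\<And>x y. 1 \<le> x \<Longrightarrow> 1 \<le> y \<Longrightarrow> 0 \<le> f (x, y)"
    and z: "(LINT p:{1..} \<times> {1..}|lebesgue. f p * (w (fst p) * w (snd p))) = 0"
    and "1 \<le> x" 
  shows "f (x, y) = 0"
proof -
  obtain q where q: "\<And>x. (LINT y:{1..}|lebesgue. f (x, y) * w y) = poly q x"
    and z': "(LINT x:{1..}|lebesgue. poly q x * w x) = 0"
    using weight2_iterated[OF f] z by metis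
  have w0: "0 \<le> w t" if "1 \<le> t" for t using w that by (simp add: weight_fun_def)
  have "0 \<le> poly q x" if "1 \<le> x" for x
    unfolding q[symmetric] set_lebesgue_integral_def
    using nn[OF that] w0 by (intro Bochner_Integration.integral_nonneg) (auto simp: indicator_def)
  then have "q = 0" by (rule weight_integral_definite[OF w _ z'])
  obtain s where s: "\<And>y. f (x, y) = poly s y" using bipoly_section(1)[OF f] by metis
  have "s = 0"
    by (rule weight_integral_definite[OF w])
       (use q[of x] nn[OF \<open>1 \<le> x\<close>] in \<open>auto simp: s \<open>q = 0\<close>\<close>)
  then show ?thesis by (simp add: s)
qed

lemma weight2_gauss:
  assumes f: "f \<in> bipoly (box2 (2 * n - 1))" and g: "gauss_weights w n x lam"
  shows "(c_w w)\<^sup>2 * (LINT p:{1..} \<times> {1..}|lebesgue. f p * (w (fst p) * w (snd p))) =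
    (\<Sum>i=1..n. \<Sum>j=1..n. lam i * lam j * f (x i, x j))"
  using f
proof (induction rule: bipoly.induct)
  case zero
  show ?case by (simp add: set_lebesgue_integral_def)
next
  case (monom i j c)
  have *: "c_w w * (LINT t:{1..}|lebesgue. t ^ k * w t) = (\<Sum>m=1..n. lam m * x m ^ k)"
    if "k \<le> 2 * n - 1" for k
  proof -
    have "degree (Polynomial.monom (1 :: real) k) \<le> 2 * n - 1"
      using that by (simp add: degree_monom_eq)
    then show ?thesis
      using g[unfolded gauss_weights_def, rule_format, of "Polynomial.monom 1 k"] by (simp add: poly_monom)
  qed
  have "(c_w w)\<^sup>2 * (LINT p:{1..} \<times> {1..}|lebesgue. c * fst p ^ i * snd p ^ j * (w (fst p) * w (snd p))) =
    c * (c_w w * (LINT t:{1..}|lebesgue. t ^ i * w t)) * (c_w w * (LINT t:{1..}|lebesgue. t ^ j * w t))"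
    by (simp add: weight2_monom(2) power2_eq_square)
  also have "\<dots> = c * (\<Sum>m=1..n. lam m * x m ^ i) * (\<Sum>m=1..n. lam m * x m ^ j)"
    using monom by (simp add: *)
  also have "\<dots> = (\<Sum>a=1..n. \<Sum>b=1..n. lam a * lam b * (c * x a ^ i * x b ^ j))"
    unfolding sum_distrib_left[of c] sum_product by (intro sum.cong refl) (simp only: mult_ac)
  finally show ?case by simp
next
  case (add f g)
  show ?case
    unfolding weight2_integral_add[OF add.hyps] distrib_left add.IH
    by (simp add: sum.distrib distrib_left)
qed

end

section \<open>The maps onto Omega\<close>

lemma power2_eq_pos: "x\<^sup>2 = y\<^sup>2 \<Longrightarrow> 0 < x \<Longrightarrow> 0 < y \<Longrightarrow> x = (y::real)"
  by (simp add: power2_eq_iff_nonneg)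

lemma elementary_map_inj: "inj_on (\<lambda>(x, y). (x + y, x * y)) triangle_dom"
proof (rule inj_onI, clarify)
  fix x y x' y' :: real
  assume t: "(x, y) \<in> triangle_dom" "(x', y') \<in> triangle_dom"
    and s: "x + y = x' + y'" and p: "x * y = x' * y'"
  have "(y - x)\<^sup>2 = (x + y)\<^sup>2 - 4 * (x * y)" "(y' - x')\<^sup>2 = (x' + y')\<^sup>2 - 4 * (x' * y')"
    by (simp_all add: power2_eq_square algebra_simps)
  then have "(y - x)\<^sup>2 = (y' - x')\<^sup>2" using s p by simp
  then have "y - x = y' - x'"
    by (rule power2_eq_pos) (use t in \<open>auto simp: triangle_dom_def\<close>)
  with s show "x = x' \<and> y = y'" by simp
qed

lemma elementary_map_image: "(\<lambda>(x, y). (x + y, x * y)) ` triangle_dom = Omega"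
proof (intro equalityI subsetI)
  fix q assume "q \<in> (\<lambda>(x, y). (x + y, x * y)) ` triangle_dom"
  then obtain x y :: real where xy: "1 < x" "x < y" and q: "q = (x + y, x * y)"
    by (auto simp: triangle_dom_def)
  have "0 < (x - 1) * (y - 1)" "0 < (x - y)\<^sup>2" using xy by auto
  then show "q \<in> Omega" using xy
    by (auto simp: q Omega_def power2_eq_square algebra_simps)
next
  fix q assume "q \<in> Omega"
  then obtain u v where q: "q = (u, v)" and uv: "2 < u" "u - 1 < v" "v < u\<^sup>2 / 4"
    by (auto simp: Omega_def)
  \<comment> \<open>\<open>(u - r) / 2\<close> and \<open>(u + r) / 2\<close> are the roots of
    \<open>z\<^sup>2 - u * z + v\<close>; the condition \<open>u - 1 < v\<close> places the smaller
    one above 1.\<close>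
  define r where "r = sqrt (u\<^sup>2 - 4 * v)"
  have r: "0 < r" "r\<^sup>2 = u\<^sup>2 - 4 * v" using uv by (auto simp: r_def)
  have "r\<^sup>2 < (u - 2)\<^sup>2" using uv r by (simp add: power2_eq_square algebra_simps)
  then have "r < u - 2" by (rule power2_less_imp_less) (use uv in simp)
  then have "((u - r) / 2, (u + r) / 2) \<in> triangle_dom" using r by (simp add: triangle_dom_def)
  moreover have "(u - r) / 2 * ((u + r) / 2) = v"
    using r by (simp add: power2_eq_square algebra_simps)
  ultimately show "q \<in> (\<lambda>(x, y). (x + y, x * y)) ` triangle_dom"
    by (intro image_eqI[of _ _ "((u - r) / 2, (u + r) / 2)"]) (auto simp: q add_divide_distrib[symmetric])
qed

text \<open>\<open>u\<^sup>2 - 4 * v\<close> is the discriminant \<open>(x - y)\<^sup>2\<close>, so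
  the power in the weight is the reciprocal of the Jacobian of the elementary map.\<close>

lemma W_mhalf_elementary:
  assumes "(x, y) \<in> triangle_dom"
  shows "W_mhalf w (x + y, x * y) * \<bar>x - y\<bar> = w x * w y"
proof -
  have "inv_into triangle_dom (\<lambda>(x, y). (x + y, x * y)) (x + y, x * y) = (x, y)"
    using inv_into_f_f[OF elementary_map_inj assms] by simp
  moreover have "(x + y)\<^sup>2 - 4 * (x * y) = (x - y)\<^sup>2" by (simp add: power2_eq_square algebra_simps)
  moreover have "\<bar>(x - y)\<^sup>2\<bar> powr (-1/2) = 1 / \<bar>x - y\<bar>"
    using assms powr_half_sqrt[of "(x - y)\<^sup>2"] powr_minus_divide[of "(x - y)\<^sup>2" "1/2"]
    by (simp add: triangle_dom_def)
  ultimately show ?thesis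
    using assms by (simp add: W_mhalf_def triangle_dom_def)
qed

lemma quadratic_map_inj: "inj_on (\<lambda>(x, y). (2 * x * y, x\<^sup>2 + y\<^sup>2 - 1)) triangle_dom"
proof (rule inj_onI, clarify)
  fix x y x' y' :: real
  assume t: "(x, y) \<in> triangle_dom" "(x', y') \<in> triangle_dom"
    and s: "2 * x * y = 2 * x' * y'" and p: "x\<^sup>2 + y\<^sup>2 - 1 = x'\<^sup>2 + y'\<^sup>2 - 1"
  have "(y - x)\<^sup>2 = (y' - x')\<^sup>2" "(y + x)\<^sup>2 = (y' + x')\<^sup>2"
    using s p by (simp_all add: power2_eq_square algebra_simps)
  then have "y - x = y' - x'" "y + x = y' + x'"
    using t power2_eq_pos[of "y - x" "y' - x'"] power2_eq_pos[of "y + x" "y' + x'"]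
    by (simp_all add: triangle_dom_def)
  then show "x = x' \<and> y = y'" by simp
qed

text \<open>The two boundary curves of Omega exchange roles compared with the elementary map:
  \<open>u - 1 < v\<close> now says \<open>0 < (x - y)\<^sup>2\<close>, and
  \<open>v < u\<^sup>2 / 4\<close> says
  \<open>0 < (x\<^sup>2 - 1) * (y\<^sup>2 - 1)\<close>.\<close>

lemma quadratic_map_image: "(\<lambda>(x, y). (2 * x * y, x\<^sup>2 + y\<^sup>2 - 1)) ` triangle_dom = Omega"
proof (intro equalityI subsetI)
  fix q assume "q \<in> (\<lambda>(x, y). (2 * x * y, x\<^sup>2 + y\<^sup>2 - 1)) ` triangle_dom"
  then obtain x y :: real where xy: "1 < x" "x < y" and q: "q = (2 * x * y, x\<^sup>2 + y\<^sup>2 - 1)"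
    by (auto simp: triangle_dom_def)
  have "1 < x\<^sup>2" "1 < y\<^sup>2" using xy by (auto intro!: one_less_power)
  then have "0 < (x\<^sup>2 - 1) * (y\<^sup>2 - 1)" by simp
  moreover have "1 < x * y" using xy by (intro less_1_mult) auto
  moreover have "0 < (x - y)\<^sup>2" using xy by simp
  ultimately show "q \<in> Omega"
    by (auto simp: q Omega_def power2_eq_square algebra_simps)
next
  fix q assume "q \<in> Omega"
  then obtain u v where q: "q = (u, v)" and uv: "2 < u" "u - 1 < v" "v < u\<^sup>2 / 4"
    by (auto simp: Omega_def)
  \<comment> \<open>\<open>s\<close> and \<open>d\<close> are the intended \<open>x + y\<close> and
    \<open>y - x\<close>.\<close>
  define s d where "s = sqrt (v + 1 + u)" and "d = sqrt (v + 1 - u)"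
  have d: "0 < d" "d\<^sup>2 = v + 1 - u" and s: "0 < s" "s\<^sup>2 = v + 1 + u"
    using uv by (auto simp: d_def s_def)
  \<comment> \<open>This is \<open>v < u\<^sup>2 / 4\<close> rewritten. Since
    \<open>s\<^sup>2 - d\<^sup>2 = 2 * u\<close>, it leads to \<open>d + 2 < s\<close>, that is, to
    a first coordinate above 1.\<close>
  have "d\<^sup>2 < ((u - 2) / 2)\<^sup>2" using uv d by (simp add: power2_eq_square field_simps)
  then have "d < (u - 2) / 2" by (rule power2_less_imp_less) (use uv in simp)
  then have "(d + 2)\<^sup>2 < s\<^sup>2" using d s by (simp add: power2_eq_square algebra_simps)
  then have "d + 2 < s" by (rule power2_less_imp_less) (use s in simp)
  then have "((s - d) / 2, (s + d) / 2) \<in> triangle_dom" using d by (simp add: triangle_dom_def)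
  moreover have "2 * ((s - d) / 2) * ((s + d) / 2) = (s\<^sup>2 - d\<^sup>2) / 2"
    "((s - d) / 2)\<^sup>2 + ((s + d) / 2)\<^sup>2 = (s\<^sup>2 + d\<^sup>2) / 2"
    by (simp_all add: power2_eq_square field_simps)
  ultimately show "q \<in> (\<lambda>(x, y). (2 * x * y, x\<^sup>2 + y\<^sup>2 - 1)) ` triangle_dom"
    using d s by (intro image_eqI[of _ _ "((s - d) / 2, (s + d) / 2)"]) (auto simp: q)
qed

lemma triangle_dom_borel: "triangle_dom \<in> sets borel"
proof -
  have "triangle_dom = {p. 1 < fst p} \<inter> {p. fst p < snd p}"
    by (auto simp: triangle_dom_def)
  moreover have "open {p :: real \<times> real. 1 < fst p}" "open {p :: real \<times> real. fst p < snd p}"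
    by (intro open_Collect_less continuous_intros)+
  ultimately show ?thesis by (metis borel_open open_Int)
qed

lemma triangle_dom_lebesgue: "triangle_dom \<in> sets lebesgue"
  using triangle_dom_borel by simp

lemma set_integral_elementary:
  fixes f :: "real \<times> real \<Rightarrow> real"
  shows "set_integrable lebesgue Omega (\<lambda>p. f p * W_mhalf w p) \<longleftrightarrow>
      set_integrable lebesgue triangle_dom (\<lambda>p. f (fst p + snd p, fst p * snd p) * (w (fst p) * w (snd p)))"
    and "(LINT p:Omega|lebesgue. f p * W_mhalf w p) =
      (LINT p:triangle_dom|lebesgue. f (fst p + snd p, fst p * snd p) * (w (fst p) * w (snd p)))"
proof -
  let ?E = "\<lambda>(x, y). (x + y, x * y :: real)"
  have der: "(?E has_derivative (\<lambda>h. (1 * fst h + 1 * snd h, snd p * fst h + fst p * snd h))) (at p)" for p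
    unfolding case_prod_unfold by (auto intro!: derivative_eq_intros simp: algebra_simps)
  have eq: "\<bar>1 * fst p - 1 * snd p\<bar> * (f (?E p) * W_mhalf w (?E p)) =
      f (fst p + snd p, fst p * snd p) * (w (fst p) * w (snd p))" if "p \<in> triangle_dom" for p
    using W_mhalf_elementary[of "fst p" "snd p" w] that
    by (auto simp: case_prod_unfold mult_ac)
  note cov = set_integral_change_of_variables_plane[OF triangle_dom_lebesgue elementary_map_inj der,
      of "\<lambda>p. f p * W_mhalf w p", unfolded elementary_map_image]
  show "set_integrable lebesgue Omega (\<lambda>p. f p * W_mhalf w p) \<longleftrightarrow>
      set_integrable lebesgue triangle_dom (\<lambda>p. f (fst p + snd p, fst p * snd p) * (w (fst p) * w (snd p)))"
    unfolding cov(1)[symmetric] by (rule set_integrable_cong[OF refl refl]) (rule eq)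
  show "(LINT p:Omega|lebesgue. f p * W_mhalf w p) =
      (LINT p:triangle_dom|lebesgue. f (fst p + snd p, fst p * snd p) * (w (fst p) * w (snd p)))"
    unfolding cov(2)[symmetric] by (rule set_lebesgue_integral_cong) (use eq triangle_dom_lebesgue in auto)
qed

text \<open>The Jacobian is 4 times the factor \<open>\<bar>x\<^sup>2 - y\<^sup>2\<bar>\<close>
  built into \<open>W_cal\<close>, and only the 4 is left over.\<close>

lemma set_integral_quadratic:
  fixes f :: "real \<times> real \<Rightarrow> real"
  shows "set_integrable lebesgue triangle_dom (\<lambda>p. Q1 f p * W_cal w p) \<longleftrightarrow>
      set_integrable lebesgue Omega (\<lambda>p. f p * W_mhalf w p)"
    and "(LINT p:triangle_dom|lebesgue. Q1 f p * W_cal w p) =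
      1 / 4 * (LINT p:Omega|lebesgue. f p * W_mhalf w p)"
proof -
  let ?E = "\<lambda>(x, y). (2 * x * y, x\<^sup>2 + y\<^sup>2 - 1 :: real)"
  have der: "(?E has_derivative (\<lambda>h. ((2 * snd p) * fst h + (2 * fst p) * snd h,
      (2 * fst p) * fst h + (2 * snd p) * snd h))) (at p)" for p
    unfolding case_prod_unfold by (auto intro!: derivative_eq_intros simp: algebra_simps)
  have eq: "\<bar>(2 * snd p) * (2 * snd p) - (2 * fst p) * (2 * fst p)\<bar> * (f (?E p) * W_mhalf w (?E p)) =
      4 * (Q1 f p * W_cal w p)" for p
  proof -
    have "\<bar>(2 * snd p) * (2 * snd p) - (2 * fst p) * (2 * fst p)\<bar> = 4 * \<bar>(fst p)\<^sup>2 - (snd p)\<^sup>2\<bar>"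
      by (simp add: power2_eq_square abs_if)
    then show ?thesis by (simp add: Q1_def W_cal_def case_prod_unfold mult_ac)
  qed
  note cov = set_integral_change_of_variables_plane[OF triangle_dom_lebesgue quadratic_map_inj der,
      of "\<lambda>p. f p * W_mhalf w p", unfolded quadratic_map_image eq]
  show "set_integrable lebesgue triangle_dom (\<lambda>p. Q1 f p * W_cal w p) \<longleftrightarrow>
      set_integrable lebesgue Omega (\<lambda>p. f p * W_mhalf w p)"
    unfolding cov(1)[symmetric] by simp
  show "(LINT p:triangle_dom|lebesgue. Q1 f p * W_cal w p) =
      1 / 4 * (LINT p:Omega|lebesgue. f p * W_mhalf w p)"
    unfolding cov(2)[symmetric] by simp
qed

section \<open>Reflections and the splitting of G\<close>

lemma set_integral_swap:
  fixes f :: "real \<times> real \<Rightarrow> real"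
  assumes S: "S \<in> sets lebesgue"
  shows "set_integrable lebesgue (prod.swap ` S) f \<longleftrightarrow> set_integrable lebesgue S (\<lambda>p. f (prod.swap p))"
      (is ?A)
    and "(LINT p:prod.swap ` S|lebesgue. f p) = (LINT p:S|lebesgue. f (prod.swap p))" (is ?B)
proof -
  have der: "(prod.swap has_derivative (\<lambda>h. (0 * fst h + 1 * snd h, 1 * fst h + 0 * snd h))) (at p)"
    for p :: "real \<times> real"
    unfolding prod.swap_def by (auto intro!: derivative_eq_intros)
  have "inj_on prod.swap S" by (auto simp: inj_on_def)
  then show ?A ?B
    using set_integral_change_of_variables_plane[OF S _ der, of f] by simp_all
qed

lemma set_integral_uminus:
  fixes f :: "real \<times> real \<Rightarrow> real"
  assumes S: "S \<in> sets lebesgue"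
  shows "set_integrable lebesgue (uminus ` S) f \<longleftrightarrow> set_integrable lebesgue S (\<lambda>p. f (- p))" (is ?A)
    and "(LINT p:uminus ` S|lebesgue. f p) = (LINT p:S|lebesgue. f (- p))" (is ?B)
proof -
  have der: "(uminus has_derivative (\<lambda>h. ((-1) * fst h + 0 * snd h, 0 * fst h + (-1) * snd h))) (at p)"
    for p :: "real \<times> real"
    by (auto intro!: derivative_eq_intros simp: prod_eq_iff fun_eq_iff)
  have "inj_on uminus S" by simp
  then show ?A ?B
    using set_integral_change_of_variables_plane[OF S _ der, of f] by simp_all
qed

lemma set_integral_spike:
  fixes f :: "real \<times> real \<Rightarrow> real"
  assumes S: "set_integrable lebesgue S f" and "S \<subseteq> T" "negligible (T - S)"
  shows "set_integrable lebesgue T f" "(LINT p:T|lebesgue. f p) = (LINT p:S|lebesgue. f p)"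
proof -
  have n: "negligible {p \<in> S - T. f p \<noteq> 0}" "negligible {p \<in> T - S. f p \<noteq> 0}"
    using assms by (auto intro: negligible_subset)
  show T: "set_integrable lebesgue T f"
    using absolutely_integrable_spike_set_eq[OF n] S by simp
  show "(LINT p:T|lebesgue. f p) = (LINT p:S|lebesgue. f p)"
    using integral_spike_set[OF n] S T by (simp add: set_lebesgue_integral_eq_integral(2))
qed

lemma negligible_lines:
  "negligible {p :: real \<times> real. fst p = c}" "negligible {p :: real \<times> real. snd p = c}"
  "negligible {p :: real \<times> real. fst p = snd p}"
proof -
  show "negligible {p :: real \<times> real. fst p = c}"
    using negligible_hyperplane[of "(1, 0) :: real \<times> real" c] by (simp add: inner_prod_def zero_prod_def)
  show "negligible {p :: real \<times> real. snd p = c}"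
    using negligible_hyperplane[of "(0, 1) :: real \<times> real" c] by (simp add: inner_prod_def zero_prod_def)
  show "negligible {p :: real \<times> real. fst p = snd p}"
    using negligible_hyperplane[of "(1, -1) :: real \<times> real" 0] by (simp add: inner_prod_def zero_prod_def)
qed

text \<open>The square is the triangle and its mirror image up to three lines. On that null set the
  integrand may be anything, which disposes of the unspecified values of
  \<open>W_cal\<close>.\<close>

lemma set_integral_square:
  fixes f :: "real \<times> real \<Rightarrow> real"
  assumes 1: "set_integrable lebesgue triangle_dom f"
    and 2: "set_integrable lebesgue triangle_dom (\<lambda>p. f (prod.swap p))"
  shows "set_integrable lebesgue ({1..} \<times> {1..}) f"
    and "(LINT p:{1..} \<times> {1..}|lebesgue. f p) =
      (LINT p:triangle_dom|lebesgue. f p) + (LINT p:triangle_dom|lebesgue. f (prod.swap p))"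
proof -
  let ?T = "triangle_dom" and ?U = "prod.swap ` triangle_dom"
  have U: "?U \<in> sets lebesgue"
  proof -
    have "p \<in> ?U" if "prod.swap p \<in> triangle_dom" for p
      using image_eqI[of p prod.swap "prod.swap p"] that by simp
    then have "?U = prod.swap -` triangle_dom" by auto
    moreover have "prod.swap -` triangle_dom \<inter> space borel \<in> sets borel"
      by (rule measurable_sets[OF _ triangle_dom_borel])
         (auto intro!: borel_measurable_continuous_onI continuous_on_swap)
    ultimately show ?thesis by simp
  qed
  have int2: "set_integrable lebesgue ?U f"
    using 2 set_integral_swap(1)[OF triangle_dom_lebesgue] by simp
  have dis: "?T \<inter> ?U = {}" by (auto simp: triangle_dom_def)
  have sub: "?T \<union> ?U \<subseteq> {1..} \<times> {1..}" by (auto simp: triangle_dom_def)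
  have neg: "negligible ({1..} \<times> {1..} - (?T \<union> ?U))"
  proof (rule negligible_subset)
    show "negligible ({p :: real \<times> real. fst p = 1} \<union> {p. snd p = 1} \<union> {p. fst p = snd p})"
      by (intro negligible_Un negligible_lines)
    show "{1..} \<times> {1..} - (?T \<union> ?U) \<subseteq> {p. fst p = 1} \<union> {p. snd p = 1} \<union> {p. fst p = snd p}"
      by (force simp: triangle_dom_def image_iff)
  qed
  have TU: "set_integrable lebesgue (?T \<union> ?U) f"
    by (rule set_integrable_Un[OF 1 int2 triangle_dom_lebesgue U])
  show "set_integrable lebesgue ({1..} \<times> {1..}) f"
    by (rule set_integral_spike[OF TU sub neg])
  show "(LINT p:{1..} \<times> {1..}|lebesgue. f p) =
      (LINT p:?T|lebesgue. f p) + (LINT p:?T|lebesgue. f (prod.swap p))"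
    using set_integral_spike(2)[OF TU sub neg] set_integral_Un[OF dis 1 int2]
    by (simp add: set_integral_swap(2)[OF triangle_dom_lebesgue])
qed

lemma set_integral_G_dom:
  fixes f :: "real \<times> real \<Rightarrow> real"
  assumes 1: "set_integrable lebesgue ({1..} \<times> {1..}) f"
    and 2: "set_integrable lebesgue ({1..} \<times> {1..}) (\<lambda>p. f (- p))"
  shows "set_integrable lebesgue G_dom f"
    and "(LINT p:G_dom|lebesgue. f p) =
      (LINT p:{1..} \<times> {1..}|lebesgue. f p) + (LINT p:{1..} \<times> {1..}|lebesgue. f (- p))"
proof -
  let ?T = "{1..} \<times> {1..} :: (real \<times> real) set" and ?U = "{..-1} \<times> {..-1} :: (real \<times> real) set"
  have m: "?T \<in> sets lebesgue" "?U \<in> sets lebesgue"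
    using borel_closed[OF closed_Times[of "{1..} :: real set" "{1..} :: real set"]]
      borel_closed[OF closed_Times[of "{..-1} :: real set" "{..-1} :: real set"]] by simp_all
  have im: "uminus ` ?T = ?U"
  proof -
    have "p \<in> uminus ` ?T" if "p \<in> ?U" for p
      by (rule image_eqI[of _ _ "- p"]) (use that in auto)
    then show ?thesis by auto
  qed
  have int2: "set_integrable lebesgue ?U f"
    using 2 set_integral_uminus(1)[OF m(1)] im by simp
  have G: "G_dom = ?T \<union> ?U" by (auto simp: G_dom_def)
  have dis: "?T \<inter> ?U = {}" by auto
  show "set_integrable lebesgue G_dom f"
    unfolding G by (rule set_integrable_Un[OF 1 int2 m])
  show "(LINT p:G_dom|lebesgue. f p) = (LINT p:?T|lebesgue. f p) + (LINT p:?T|lebesgue. f (- p))"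
    using set_integral_Un[OF dis 1 int2] set_integral_uminus(2)[OF m(1), of f] by (simp add: G im)
qed

section \<open>Integrals over G\<close>

lemma Pi2_continuous: "f \<in> Pi2 m \<Longrightarrow> continuous_on UNIV f"
  unfolding Pi2_eq_bipoly
  by (induction rule: bipoly.induct) (auto intro!: continuous_intros)

text \<open>The quadratic map sends \<open>(s, t)\<close> to the same point as the elementary map
  sends \<open>(cosh a, cosh b)\<close>. Half sums and half differences of arguments thus describe
  one map followed by the inverse of the other.\<close>

lemma half_angle_identities:
  fixes a b :: real
  defines "s \<equiv> cosh ((a - b) / 2)" and "t \<equiv> cosh ((a + b) / 2)"
  shows "2 * s * t = cosh a + cosh b" "s\<^sup>2 + t\<^sup>2 - 1 = cosh a * cosh b"
proof -
  define p q where "p = a / 2" and "q = b / 2"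
  have st: "s = cosh p * cosh q - sinh p * sinh q" "t = cosh p * cosh q + sinh p * sinh q"
    by (simp_all add: s_def t_def p_def q_def diff_divide_distrib add_divide_distrib cosh_add cosh_diff)
  have ab: "cosh a = 2 * (cosh p)\<^sup>2 - 1" "cosh b = 2 * (cosh q)\<^sup>2 - 1"
    using cosh_double_cosh[of p] cosh_double_cosh[of q] by (simp_all add: p_def q_def)
  have sq: "(sinh p)\<^sup>2 = (cosh p)\<^sup>2 - 1" "(sinh q)\<^sup>2 = (cosh q)\<^sup>2 - 1"
    by (simp_all add: sinh_square_eq)
  have "2 * s * t = 2 * ((cosh p)\<^sup>2 * (cosh q)\<^sup>2 - (sinh p)\<^sup>2 * (sinh q)\<^sup>2)"
    unfolding st by (simp add: power2_eq_square algebra_simps)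
  then show "2 * s * t = cosh a + cosh b"
    unfolding sq ab by (simp add: algebra_simps)
  have "s\<^sup>2 + t\<^sup>2 - 1 = 2 * ((cosh p)\<^sup>2 * (cosh q)\<^sup>2 + (sinh p)\<^sup>2 * (sinh q)\<^sup>2) - 1"
    unfolding st by (simp add: power2_eq_square algebra_simps)
  then show "s\<^sup>2 + t\<^sup>2 - 1 = cosh a * cosh b"
    unfolding sq ab by (simp add: algebra_simps)
qed

text \<open>Both symmetries fix the argument passed to \<open>W_mhalf\<close>, so invariance holds
  at every point, including those where the weight is unspecified.\<close>

lemma W_cal_invariant:
  "W_cal w (prod.swap p) = W_cal w p" "W_cal w (- p) = W_cal w p"
  by (auto simp: W_cal_def case_prod_unfold add.commute mult.commute mult.left_commute abs_minus_commute)

context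
  fixes w :: "real \<Rightarrow> real"
  assumes w: "weight_fun w"
begin

text \<open>The pulled back integrand is symmetric, so the triangle carries half of the integral
  over the square; only on the square do the variables separate.\<close>

lemma Omega_integrable:
  assumes "A \<in> Pi2 m"
  shows "set_integrable lebesgue Omega (\<lambda>p. A p * W_mhalf w p)"
    and "(LINT p:Omega|lebesgue. A p * W_mhalf w p) =
      1 / 2 * (LINT p:{1..} \<times> {1..}|lebesgue. A (fst p + snd p, fst p * snd p) * (w (fst p) * w (snd p)))"
proof -
  let ?h = "\<lambda>p. A (fst p + snd p, fst p * snd p) * (w (fst p) * w (snd p))"
  have "set_integrable lebesgue triangle_dom ?h"
    by (rule set_integrable_subset[OF weight2_integrable[OF w box_subst_elementary[OF assms]] triangle_dom_lebesgue])
       (auto simp: triangle_dom_def)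
  moreover have sw: "(\<lambda>p. ?h (prod.swap p)) = ?h"
    by (intro ext) (simp add: add.commute mult.commute)
  ultimately show "set_integrable lebesgue Omega (\<lambda>p. A p * W_mhalf w p)"
    and "(LINT p:Omega|lebesgue. A p * W_mhalf w p) = 1 / 2 * (LINT p:{1..} \<times> {1..}|lebesgue. ?h p)"
    using set_integral_elementary[of A w] set_integral_square(2)[of ?h, unfolded sw] by simp_all
qed

lemma W_cal_integrable_growth:
  fixes g :: "real \<times> real \<Rightarrow> real"
  assumes cont: "continuous_on UNIV g"
    and bound: "\<And>x y. 1 \<le> x\<^sup>2 + y\<^sup>2 \<Longrightarrow> \<bar>g (x, y)\<bar> \<le> C * (x\<^sup>2 + y\<^sup>2) ^ m"
  shows "set_integrable lebesgue triangle_dom (\<lambda>p. g p * W_cal w p)"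
proof -
  have int: "set_integrable lebesgue triangle_dom (\<lambda>p. Q1 A p * W_cal w p)" if "A \<in> Pi2 k" for A k
    using set_integral_quadratic(1) Omega_integrable(1)[OF that] by blast
  \<comment> \<open>Taking the constant 1 shows that the weight itself is integrable; this supplies
    the measurability needed for the comparison.\<close>
  have "set_integrable lebesgue triangle_dom (\<lambda>p. W_cal w p)"
    using int[OF Pi2_const[of 1 0]] by (simp add: Q1_def case_prod_unfold)
  then have W: "(\<lambda>p. indicator triangle_dom p *\<^sub>R W_cal w p) \<in> borel_measurable lebesgue"
    unfolding set_integrable_def by (rule borel_measurable_integrable)
  have g: "g \<in> borel_measurable lebesgue"
    by (intro measurable_completion) (simp add: cont borel_measurable_continuous_onI)
  \<comment> \<open>\<open>snd p + 1\<close> pulls back to \<open>x\<^sup>2 + y\<^sup>2\<close>, so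
    \<open>Q1 A\<close> is the assumed bound.\<close>
  define A where "A = (\<lambda>p :: real \<times> real. C * (snd p + 1) ^ m)"
  have "(\<lambda>p. snd p + 1) \<in> Pi2 1" using Pi2_add[OF Pi2_snd[of 1] Pi2_const[of 1 1]] by simp
  then have A: "A \<in> Pi2 m"
    unfolding A_def using Pi2_scale[OF Pi2_subst[OF _ _ Pi2_monom[of 0 m m 1]], of _ 1 _ C] by simp
  show ?thesis
    unfolding set_integrable_def
  proof (rule Bochner_Integration.integrable_bound[OF int[OF A, unfolded set_integrable_def]])
    show "(\<lambda>p. indicator triangle_dom p *\<^sub>R (g p * W_cal w p)) \<in> borel_measurable lebesgue"
      using borel_measurable_times[OF g W] by (simp add: mult.left_commute)
    show "AE p in lebesgue. norm (indicat_real triangle_dom p *\<^sub>R (g p * W_cal w p)) \<le>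
        norm (indicat_real triangle_dom p *\<^sub>R (Q1 A p * W_cal w p))"
    proof (rule AE_I2)
      fix p :: "real \<times> real"
      obtain x y where p: "p = (x, y)" by (cases p)
      show "norm (indicat_real triangle_dom p *\<^sub>R (g p * W_cal w p)) \<le>
        norm (indicat_real triangle_dom p *\<^sub>R (Q1 A p * W_cal w p))"
      proof (cases "p \<in> triangle_dom")
        case True
        then have "1 \<le> x\<^sup>2" by (simp add: p triangle_dom_def)
        then have "1 \<le> x\<^sup>2 + y\<^sup>2" by (simp add: add_increasing2)
        then have "\<bar>g p\<bar> \<le> \<bar>Q1 A p\<bar>"
          using bound[of x y] by (simp add: p Q1_def A_def)
        then show ?thesis using True by (simp add: abs_mult mult_right_mono)
      qed simp
    qed
  qed
qed

text \<open>By invariance of the weight, G is folded onto the triangle and \<open>f\<close> is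
  replaced by the sum of its four images. Each image is first shown to be integrable, since only
  their sum comes from Omega.\<close>

lemma G_dom_integral:
  assumes f: "f \<in> Pi2 m"
  shows "set_integrable lebesgue G_dom (\<lambda>p. f p * W_cal w p)"
    and "(\<And>x y. f (x, y) + f (y, x) + f (-x, -y) + f (-y, -x) = A (2 * x * y, x\<^sup>2 + y\<^sup>2 - 1)) \<Longrightarrow>
      (LINT p:G_dom|lebesgue. f p * W_cal w p) = 1 / 4 * (LINT p:Omega|lebesgue. A p * W_mhalf w p)"
proof -
  obtain C where C: "\<And>x y. 1 \<le> x\<^sup>2 + y\<^sup>2 \<Longrightarrow> \<bar>f (x, y)\<bar> \<le> C * (x\<^sup>2 + y\<^sup>2) ^ m"
    using Pi2_growth[OF f] by blast
  have C': "\<bar>f (y, x)\<bar> \<le> C * (x\<^sup>2 + y\<^sup>2) ^ m" if "1 \<le> x\<^sup>2 + y\<^sup>2" for x y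
    using C[of y x] that by (simp add: add.commute)
  note cont = continuous_on_compose2[OF Pi2_continuous[OF f] _ subset_UNIV]
  let ?W = "W_cal w"
  have 1: "set_integrable lebesgue triangle_dom (\<lambda>p. f p * ?W p)"
    by (rule W_cal_integrable_growth[OF Pi2_continuous[OF f]]) (rule C)
  have 2: "set_integrable lebesgue triangle_dom (\<lambda>p. f (prod.swap p) * ?W p)"
    by (rule W_cal_integrable_growth[of _ C m])
       (auto intro!: cont continuous_intros continuous_on_swap simp: C')
  have 3: "set_integrable lebesgue triangle_dom (\<lambda>p. f (- p) * ?W p)"
    by (rule W_cal_integrable_growth[of _ C m])
       (use C[of "- _" "- _"] in \<open>auto intro!: cont continuous_intros\<close>)
  have 4: "set_integrable lebesgue triangle_dom (\<lambda>p. f (- prod.swap p) * ?W p)"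
    by (rule W_cal_integrable_growth[of _ C m])
       (use C'[of "- _" "- _"] in \<open>auto intro!: cont continuous_intros continuous_on_swap\<close>)
  let ?S = "{1..} \<times> {1..} :: (real \<times> real) set"
  have a: "set_integrable lebesgue ?S (\<lambda>p. f p * ?W p)"
    "(LINT p:?S|lebesgue. f p * ?W p) =
      (LINT p:triangle_dom|lebesgue. f p * ?W p) + (LINT p:triangle_dom|lebesgue. f (prod.swap p) * ?W p)"
    using set_integral_square[of "\<lambda>p. f p * ?W p"] 1 2 by (simp_all add: W_cal_invariant)
  have b: "set_integrable lebesgue ?S (\<lambda>p. f (- p) * ?W p)"
    "(LINT p:?S|lebesgue. f (- p) * ?W p) =
      (LINT p:triangle_dom|lebesgue. f (- p) * ?W p) + (LINT p:triangle_dom|lebesgue. f (- prod.swap p) * ?W p)"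
    using set_integral_square[of "\<lambda>p. f (- p) * ?W p"] 3 4 by (simp_all add: W_cal_invariant)
  show "set_integrable lebesgue G_dom (\<lambda>p. f p * ?W p)"
    using set_integral_G_dom(1)[of "\<lambda>p. f p * ?W p"] a b by (simp add: W_cal_invariant)
  show "(LINT p:G_dom|lebesgue. f p * ?W p) = 1 / 4 * (LINT p:Omega|lebesgue. A p * W_mhalf w p)"
    if A: "\<And>x y. f (x, y) + f (y, x) + f (-x, -y) + f (-y, -x) = A (2 * x * y, x\<^sup>2 + y\<^sup>2 - 1)"
  proof -
    have "(LINT p:G_dom|lebesgue. f p * ?W p) =
        (LINT p:?S|lebesgue. f p * ?W p) + (LINT p:?S|lebesgue. f (- p) * ?W p)"
      using set_integral_G_dom(2)[of "\<lambda>p. f p * ?W p"] a b by (simp add: W_cal_invariant)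
    also have "\<dots> = (LINT p:triangle_dom|lebesgue. f p * ?W p + f (prod.swap p) * ?W p +
        (f (- p) * ?W p + f (- prod.swap p) * ?W p))"
      unfolding a b using 1 2 3 4 by (simp add: set_integral_add)
    also have "\<dots> = (LINT p:triangle_dom|lebesgue. Q1 A p * ?W p)"
    proof -
      have "f p * ?W p + f (prod.swap p) * ?W p + (f (- p) * ?W p + f (- prod.swap p) * ?W p) = Q1 A p * ?W p" for p
        using A[of "fst p" "snd p", symmetric] by (cases p) (simp add: Q1_def algebra_simps)
      then show ?thesis by simp
    qed
    finally show ?thesis by (simp add: set_integral_quadratic(2))
  qed
qed

lemma G_dom_integral_square:
  assumes f: "f \<in> Pi2 m" and A: "A \<in> Pi2 k"
    and fA: "\<And>x y. f (x, y) + f (y, x) + f (-x, -y) + f (-y, -x) = A (2 * x * y, x\<^sup>2 + y\<^sup>2 - 1)"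
  shows "(LINT p:G_dom|lebesgue. f p * W_cal w p) =
    1 / 8 * (LINT p:{1..} \<times> {1..}|lebesgue. A (fst p + snd p, fst p * snd p) * (w (fst p) * w (snd p)))"
  using G_dom_integral(2)[OF f, of A] fA Omega_integrable(2)[OF A] by simp

lemma G_dom_integral_odd:
  assumes f: "f \<in> Pi2 m" and odd: "\<And>p. f (- p) = - f p"
  shows "(LINT p:G_dom|lebesgue. f p * W_cal w p) = 0"
proof -
  have "f (x, y) + f (y, x) + f (-x, -y) + f (-y, -x) = (\<lambda>_. 0) (2 * x * y, x\<^sup>2 + y\<^sup>2 - 1)" for x y
    using odd[of "(x, y)"] odd[of "(y, x)"] by simp
  then show ?thesis
    using G_dom_integral(2)[OF f, of "\<lambda>_. 0"] by (simp add: set_lebesgue_integral_def)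
qed

text \<open>The symmetrized square is a sum of four squares, so \<open>A\<close> is nonnegative
  where the product weight lives; its vanishing there forces each square to vanish.\<close>

lemma G_dom_integral_definite:
  assumes f: "f \<in> Pi2 m" and z: "(LINT p:G_dom|lebesgue. f p * f p * W_cal w p) = 0"
  shows "f p = 0"
proof -
  have ff: "(\<lambda>p. f p * f p) \<in> Pi2 (m + m)" by (rule Pi2_mult[OF f f])
  obtain A where A: "A \<in> Pi2 ((m + m) div 2)"
    and fA: "\<And>x y. f (x, y) * f (x, y) + f (y, x) * f (y, x) + f (-x, -y) * f (-x, -y) + f (-y, -x) * f (-y, -x)
      = A (2 * x * y, x\<^sup>2 + y\<^sup>2 - 1)"
    using Pi2_symmetrize[OF ff] by blast
  have elem: "A (cosh a + cosh b, cosh a * cosh b) = A (2 * s * t, s\<^sup>2 + t\<^sup>2 - 1)"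
    if "s = cosh ((a - b) / 2)" "t = cosh ((a + b) / 2)" for a b s t :: real
    unfolding that half_angle_identities ..
  have nn: "0 \<le> A (x + y, x * y)" if "1 \<le> x" "1 \<le> y" for x y
  proof -
    \<comment> \<open>Hyperbolic arguments allow the half-angle identities to lead back to a point
      where \<open>A\<close> is the sum of four squares.\<close>
    have "A (x + y, x * y) = A (cosh (arcosh x) + cosh (arcosh y), cosh (arcosh x) * cosh (arcosh y))"
      using that by simp
    also have "0 \<le> \<dots>"
      unfolding elem[OF refl refl] fA[symmetric] by simp
    finally show ?thesis .
  qed
  have "(LINT p:{1..} \<times> {1..}|lebesgue. A (fst p + snd p, fst p * snd p) * (w (fst p) * w (snd p))) = 0"
    using G_dom_integral_square[OF ff A] fA z by simp
  then have A0: "A (x + y, x * y) = 0" if "1 \<le> x" for x y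
    using weight2_integral_definite[OF w box_subst_elementary[OF A], of x y] nn that by simp
  show ?thesis
  proof (rule Pi2_eq_0_on_rectangle[OF f, of "{1..}" "{1..}"])
    fix x y :: real assume "x \<in> {1..}" "y \<in> {1..}"
    then have xy: "x = cosh (arcosh x)" "y = cosh (arcosh y)" by auto
    \<comment> \<open>Chosen so that \<open>(a - b) / 2 = arcosh x\<close> and
      \<open>(a + b) / 2 = arcosh y\<close>, the passage in the opposite direction.\<close>
    define a b where "a = arcosh y + arcosh x" and "b = arcosh y - arcosh x"
    have "A (2 * x * y, x\<^sup>2 + y\<^sup>2 - 1) = A (cosh a + cosh b, cosh a * cosh b)"
      by (rule elem[symmetric]) (use xy in \<open>simp_all add: a_def b_def\<close>)
    also have "\<dots> = 0" by (rule A0) (rule cosh_real_ge_1)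
    finally have "f (x, y) * f (x, y) + f (y, x) * f (y, x) + f (-x, -y) * f (-x, -y) + f (-y, -x) * f (-y, -x) = 0"
      by (simp add: fA)
    moreover have "0 \<le> f (x, y) * f (x, y)" "0 \<le> f (y, x) * f (y, x)"
      "0 \<le> f (-x, -y) * f (-x, -y)" "0 \<le> f (-y, -x) * f (-y, -x)" by simp_all
    ultimately have "f (x, y) * f (x, y) = 0" by linarith
    then show "f (x, y) = 0" by simp
  qed (auto simp: infinite_Ici)
qed

end

section \<open>Gauss nodes and the cubature rule\<close>

lemma lagrange_basis:
  fixes x :: "nat \<Rightarrow> real"
  assumes inj: "inj_on x {1..n}" and j: "j \<in> {1..n}"
  shows "\<exists>l. degree l \<le> n - 1 \<and> (\<forall>i\<in>{1..n}. poly l (x i) = (if i = j then 1 else 0))"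
proof -
  let ?l = "\<Prod>i\<in>{1..n} - {j}. smult (1 / (x j - x i)) [:- x i, 1:]"
  have "degree ?l \<le> (\<Sum>i\<in>{1..n} - {j}. degree (smult (1 / (x j - x i)) [:- x i, 1:]))"
    by (rule degree_prod_sum_le[THEN order_trans]) (auto simp: o_def)
  also have "\<dots> \<le> (\<Sum>i\<in>{1..n} - {j}. 1)"
    by (intro sum_mono order_trans[OF degree_smult_le]) simp
  also have "\<dots> = n - 1" using j by simp
  finally have "degree ?l \<le> n - 1" .
  moreover have "poly ?l (x i) = (if i = j then 1 else 0)" if i: "i \<in> {1..n}" for i
  proof -
    have eval: "poly ?l t = (\<Prod>k\<in>{1..n} - {j}. (t - x k) / (x j - x k))" for t
      unfolding poly_prod by (intro prod.cong refl) (simp add: diff_divide_distrib)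
    have "x j - x k \<noteq> 0" if "k \<in> {1..n} - {j}" for k
      using inj_onD[OF inj, of j k] j that by auto
    then have "poly ?l (x j) = 1" unfolding eval by (intro prod.neutral ballI) simp
    moreover have "poly ?l (x i) = 0" if "i \<noteq> j"
      unfolding eval by (rule prod_zero) (use i that in auto)
    ultimately show ?thesis by auto
  qed
  ultimately show ?thesis by blast
qed

lemma orth_polys_integral_eq_0:
  assumes "P \<in> orth_polys D W m" "q \<in> Pi2 m'" "m' < m"
  shows "(LINT p:D|lebesgue. P p * q p * W p) = 0"
  using assms unfolding orth_polys_def by blast

lemma poly_product_box:
  assumes "degree p \<le> m" "degree q \<le> m"
  shows "(\<lambda>z. poly p (fst z) * poly q (snd z)) \<in> bipoly (box2 m)"
proof (rule bipoly_mult)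
  have "(\<lambda>z. coeff p i * fst z ^ i * snd z ^ 0) \<in> bipoly ({..m} \<times> {0})" if "i \<le> m" for i
    using that by (intro bipoly.monom) simp
  then have "(\<lambda>z. \<Sum>i\<le>degree p. coeff p i * fst z ^ i * snd z ^ 0) \<in> bipoly ({..m} \<times> {0})"
    using assms by (intro bipoly_sum) auto
  then show "(\<lambda>z. poly p (fst z)) \<in> bipoly ({..m} \<times> {0})" by (simp add: poly_altdef)
  have "(\<lambda>z. coeff q i * fst z ^ 0 * snd z ^ i) \<in> bipoly ({0} \<times> {..m})" if "i \<le> m" for i
    using that by (intro bipoly.monom) simp
  then have "(\<lambda>z. \<Sum>i\<le>degree q. coeff q i * fst z ^ 0 * snd z ^ i) \<in> bipoly ({0} \<times> {..m})"
    using assms by (intro bipoly_sum) auto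
  then show "(\<lambda>z. poly q (snd z)) \<in> bipoly ({0} \<times> {..m})" by (simp add: poly_altdef)
qed auto

text \<open>The rule is exact for the square of a Lagrange polynomial, of degree at most
  \<open>2 * n - 2\<close>; hence \<open>lam j\<close> is \<open>c_w w\<close> times the integral of
  that square against \<open>w\<close>, which cannot be 0.\<close>

lemma gauss_weight_nonzero:
  assumes w: "weight_fun w" and g: "gauss_weights w n x lam" and inj: "inj_on x {1..n}"
    and j: "j \<in> {1..n}"
  shows "lam j \<noteq> 0"
proof
  assume "lam j = 0"
  obtain l where l: "degree l \<le> n - 1" "\<And>i. i \<in> {1..n} \<Longrightarrow> poly l (x i) = (if i = j then 1 else 0)"
    using lagrange_basis[OF inj j] by blast
  have "degree (l * l) \<le> 2 * n - 1"
    using degree_mult_le[of l l] l(1) by simp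
  then have "c_w w * (LINT t:{1..}|lebesgue. poly (l * l) t * w t) = (\<Sum>k=1..n. lam k * poly (l * l) (x k))"
    using g unfolding gauss_weights_def by blast
  also have "\<dots> = 0" using l(2) \<open>lam j = 0\<close> by (intro sum.neutral) auto
  finally have "(LINT t:{1..}|lebesgue. poly (l * l) t * w t) = 0"
    using w by (simp add: c_w_def weight_fun_def)
  then have "l * l = 0" by (intro weight_integral_definite[OF w]) auto
  then show False using l(2)[OF j] by simp
qed

lemma orth_poly_vanishes_at_gauss_pair:
  assumes w: "weight_fun w" and n: "1 \<le> n" and g: "gauss_weights w n x lam"
    and inj: "inj_on x {1..n}" and P: "P \<in> orth_polys Omega (W_mhalf w) n"
    and j: "j \<in> {1..n}" and k: "k \<in> {1..n}"
  shows "P (x j + x k, x j * x k) = 0"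
proof -
  obtain l where l: "degree l \<le> n - 1" "\<And>i. i \<in> {1..n} \<Longrightarrow> poly l (x i) = (if i = j then 1 else 0)"
    using lagrange_basis[OF inj j] by blast
  obtain r where r: "degree r \<le> n - 1" "\<And>i. i \<in> {1..n} \<Longrightarrow> poly r (x i) = (if i = k then 1 else 0)"
    using lagrange_basis[OF inj k] by blast
  obtain A where A: "A \<in> Pi2 (n - 1)"
    and hA: "\<And>x y. poly l x * poly r y + poly l y * poly r x = A (x + y, x * y)"
    using box_symmetrize[OF poly_product_box[OF l(1) r(1)]] by auto
  have Pn: "P \<in> Pi2 n" using P by (simp add: orth_polys_def)
  \<comment> \<open>Degree \<open>n + (n - 1)\<close> is the most that the Gauss rule
    allows.\<close>
  have PA: "(\<lambda>p. P p * A p) \<in> Pi2 (2 * n - 1)"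
    using Pi2_mono[OF Pi2_mult[OF Pn A]] n by simp
  have "(LINT p:Omega|lebesgue. P p * A p * W_mhalf w p) = 0"
    by (rule orth_polys_integral_eq_0[OF P A]) (use n in simp)
  then have "(LINT p:{1..} \<times> {1..}|lebesgue. P (fst p + snd p, fst p * snd p) * A (fst p + snd p, fst p * snd p) *
      (w (fst p) * w (snd p))) = 0"
    using Omega_integrable(2)[OF w PA] by simp
  then have "0 = (\<Sum>a=1..n. \<Sum>b=1..n. lam a * lam b * (P (x a + x b, x a * x b) * A (x a + x b, x a * x b)))"
    using weight2_gauss[OF w box_subst_elementary[OF PA] g] by simp
  \<comment> \<open>Only the index pairs \<open>(j, k)\<close> and \<open>(k, j)\<close> contribute.
    They are kept as two terms so that \<open>j = k\<close>, where both fall on the same pair, also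
    yields the factor 2.\<close>
  also have "\<dots> = (\<Sum>a=1..n. \<Sum>b=1..n.
      (if b = k then if a = j then lam j * lam k * P (x j + x k, x j * x k) else 0 else 0) +
      (if b = j then if a = k then lam j * lam k * P (x j + x k, x j * x k) else 0 else 0))"
    by (intro sum.cong refl)
       (auto simp: hA[symmetric] l(2) r(2) add.commute mult.commute)
  also have "\<dots> = 2 * (lam j * lam k * P (x j + x k, x j * x k))"
    using j k by (simp add: sum.distrib)
  finally show ?thesis
    using gauss_weight_nonzero[OF w g inj j] gauss_weight_nonzero[OF w g inj k] by simp
qed

lemma sum_symmetric_square:
  fixes g :: "nat \<Rightarrow> nat \<Rightarrow> real"
  assumes sym: "\<And>i j. g i j = g j i"
  shows "(\<Sum>k=1..n. \<Sum>j=1..n. g j k) = 2 * (\<Sum>k=1..n. \<Sum>j=1..k. (if j = k then 1 / 2 else 1) * g j k)"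
proof (induction n)
  case (Suc n)
  have "(\<Sum>j=1..n. (if j = Suc n then 1 / 2 else 1) * g j (Suc n)) = (\<Sum>j=1..n. g j (Suc n))"
    by (intro sum.cong) auto
  moreover have "(\<Sum>k=1..n. g (Suc n) k) = (\<Sum>j=1..n. g j (Suc n))"
    by (intro sum.cong sym) simp
  ultimately show ?case
    using Suc by (simp add: sum.distrib)
qed simp

text \<open>Indices sharing a node have their weights added, which turns an indexed rule into one
  indexed by points without first separating the nodes.\<close>

lemma node_combination:
  assumes X: "finite X" and I: "finite I" and v: "\<And>i. i \<in> I \<Longrightarrow> v i \<in> X"
  shows "\<exists>\<omega>. \<forall>f :: 'a \<Rightarrow> real. (\<Sum>i\<in>I. c i * f (v i)) = (\<Sum>p\<in>X. \<omega> p * f p)"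
proof (intro exI allI)
  fix f :: "'a \<Rightarrow> real"
  have "(\<Sum>i\<in>I. c i * f (v i)) = (\<Sum>p\<in>X. \<Sum>i\<in>{i \<in> I. v i = p}. c i * f (v i))"
    using v by (intro sum.group[symmetric] I X) auto
  also have "\<dots> = (\<Sum>p\<in>X. (\<Sum>i\<in>{i \<in> I. v i = p}. c i) * f p)"
    by (intro sum.cong refl) (auto simp: sum_distrib_right intro!: sum.cong)
  finally show "(\<Sum>i\<in>I. c i * f (v i)) = (\<Sum>p\<in>X. (\<Sum>i\<in>{i \<in> I. v i = p}. c i) * f p)" .
qed

section \<open>The node set, its minimality, and the polynomials of degree 2n\<close>

context
  fixes w :: "real \<Rightarrow> real" and n :: nat and x lam \<theta> :: "nat \<Rightarrow> real"
  assumes w: "weight_fun w" and n: "1 \<le> n" and gauss: "gauss_weights w n x lam"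
    and inj: "inj_on x {1..n}" and theta: "\<And>k. k \<in> {1..n} \<Longrightarrow> x k = cosh (\<theta> k)"
begin

lemma node_identities:
  assumes "j \<in> {1..n}" "k \<in> {1..n}"
  shows "2 * s_node \<theta> j k * t_node \<theta> j k = x j + x k"
    and "(s_node \<theta> j k)\<^sup>2 + (t_node \<theta> j k)\<^sup>2 - 1 = x j * x k"
  using half_angle_identities[of "\<theta> j" "\<theta> k"] assms by (simp_all add: s_node_def t_node_def theta)

lemma cubature_formula:
  assumes f: "f \<in> Pi2 (4 * n - 1)"
  shows "(c_w w)\<^sup>2 * (LINT q:G_dom|lebesgue. f q * W_cal w q) =
    1 / 4 * (\<Sum>k=1..n. \<Sum>j=1..k. (if j = k then 1 / 2 else 1) * (lam j * lam k *
      (f (s_node \<theta> j k, t_node \<theta> j k) + f (t_node \<theta> j k, s_node \<theta> j k)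
        + f (- s_node \<theta> j k, - t_node \<theta> j k) + f (- t_node \<theta> j k, - s_node \<theta> j k))))"
    (is "_ = 1 / 4 * (\<Sum>k=1..n. \<Sum>j=1..k. ?c j k * (lam j * lam k * ?f j k))")
proof -
  obtain A where A: "A \<in> Pi2 ((4 * n - 1) div 2)"
    and fA: "\<And>x y. f (x, y) + f (y, x) + f (-x, -y) + f (-y, -x) = A (2 * x * y, x\<^sup>2 + y\<^sup>2 - 1)"
    using Pi2_symmetrize[OF f] by blast
  \<comment> \<open>\<open>(4 * n - 1) div 2\<close> is \<open>2 * n - 1\<close>, exactly the degree
    of the Gauss rule.\<close>
  have A': "A \<in> Pi2 (2 * n - 1)" by (rule Pi2_mono[OF A]) simp
  have fA': "?f j k = A (x j + x k, x j * x k)" if "j \<in> {1..n}" "k \<in> {1..n}" for j k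
    using fA[of "s_node \<theta> j k" "t_node \<theta> j k"] node_identities[OF that] by simp
  have "(c_w w)\<^sup>2 * (LINT q:G_dom|lebesgue. f q * W_cal w q) =
      1 / 8 * ((c_w w)\<^sup>2 * (LINT p:{1..} \<times> {1..}|lebesgue. A (fst p + snd p, fst p * snd p) * (w (fst p) * w (snd p))))"
    using G_dom_integral_square[OF w f A'] fA by simp
  also have "\<dots> = 1 / 8 * (\<Sum>k=1..n. \<Sum>j=1..n. lam k * lam j * A (x k + x j, x k * x j))"
    by (simp add: weight2_gauss[OF w box_subst_elementary[OF A'] gauss])
  \<comment> \<open>Folding the square of indices onto \<open>j \<le> k\<close> doubles every term
    off the diagonal, hence the halved diagonal; the factor 2 turns 1/8 into 1/4.\<close>
  also have "(\<Sum>k=1..n. \<Sum>j=1..n. lam k * lam j * A (x k + x j, x k * x j)) =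
      2 * (\<Sum>k=1..n. \<Sum>j=1..k. ?c j k * (lam j * lam k * A (x j + x k, x j * x k)))"
    using sum_symmetric_square[of "\<lambda>j k. lam j * lam k * A (x j + x k, x j * x k)" n]
    by (simp add: add.commute mult.commute)
  also have "(\<Sum>k=1..n. \<Sum>j=1..k. ?c j k * (lam j * lam k * A (x j + x k, x j * x k))) =
      (\<Sum>k=1..n. \<Sum>j=1..k. ?c j k * (lam j * lam k * ?f j k))"
    by (intro sum.cong refl) (simp add: fA')
  finally show ?thesis by simp
qed

lemma cub_nodes_finite: "finite (cub_nodes \<theta> n)"
  by (simp add: cub_nodes_def)

text \<open>An upper bound suffices for minimality: every rule of this degree, the present one
  included, has at least as many nodes by Moeller's bound.\<close>

lemma card_cub_nodes_le: "card (cub_nodes \<theta> n) \<le> 2 * n * (n + 1)"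
proof -
  have four: "card {a, b, c, d} \<le> 4" for a b c d :: "real \<times> real"
    using card_insert_le_m1[of 4 "{b, c, d}" a] card_insert_le_m1[of 3 "{c, d}" b]
      card_insert_le_m1[of 2 "{d}" c] by simp
  have "card (cub_nodes \<theta> n) \<le> (\<Sum>k=1..n. \<Sum>j=1..k. 4)"
    unfolding cub_nodes_def
    by (intro order_trans[OF card_UN_le] sum_mono four) simp_all
  also have "\<dots> = 4 * (\<Sum>k=1..n. k)" by (simp add: sum_distrib_left mult.commute)
  also have "\<dots> = 2 * n * (n + 1)" by (induction n) auto
  finally show ?thesis .
qed

lemma cub_nodes_are_cubature_nodes: "cubature_nodes G_dom (W_cal w) (4 * n - 1) (cub_nodes \<theta> n)"
proof -
  \<comment> \<open>\<open>e\<close> numbers the four reflected copies of a node; the division in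
    \<open>?c\<close> removes the normalization of the integral.\<close>
  let ?v = "\<lambda>(k, j, e :: nat). let s = s_node \<theta> j k; t = t_node \<theta> j k in
    if e = 0 then (s, t) else if e = 1 then (t, s) else if e = 2 then (- s, - t) else (- t, - s)"
  let ?I = "Sigma {1..n} (\<lambda>k. {1..k} \<times> {..<4 :: nat})"
  let ?c = "\<lambda>(k, j, e :: nat). 1 / 4 * ((if j = k then 1 / 2 else 1) * (lam j * lam k)) / (c_w w)\<^sup>2"
  have c0: "c_w w \<noteq> 0" using w by (simp add: c_w_def weight_fun_def)
  have "?v i \<in> cub_nodes \<theta> n" if "i \<in> ?I" for i
  proof -
    obtain k j e where i: "i = (k, j, e)" and kj: "k \<in> {1..n}" "j \<in> {1..k}" using \<open>i \<in> ?I\<close> by auto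
    have "{(s_node \<theta> j k, t_node \<theta> j k), (t_node \<theta> j k, s_node \<theta> j k),
        (- s_node \<theta> j k, - t_node \<theta> j k), (- t_node \<theta> j k, - s_node \<theta> j k)} \<subseteq> cub_nodes \<theta> n"
      using kj unfolding cub_nodes_def by blast
    then show ?thesis by (simp add: i Let_def)
  qed
  then obtain \<omega> where \<omega>: "\<And>f :: real \<times> real \<Rightarrow> real. (\<Sum>i\<in>?I. ?c i * f (?v i)) = (\<Sum>p\<in>cub_nodes \<theta> n. \<omega> p * f p)"
    using node_combination[OF cub_nodes_finite, of ?I ?v ?c] by blast
  have triple: "(\<Sum>i\<in>?I. F i) = (\<Sum>k=1..n. \<Sum>j=1..k. \<Sum>e<4. F (k, j, e))"
    for F :: "nat \<times> nat \<times> nat \<Rightarrow> real"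
  proof -
    have "(\<Sum>i\<in>?I. F i) = (\<Sum>k=1..n. \<Sum>z\<in>{1..k} \<times> {..<4}. F (k, z))"
      by (subst sum.Sigma) auto
    also have "\<dots> = (\<Sum>k=1..n. \<Sum>j=1..k. \<Sum>e<4. F (k, j, e))"
      by (intro sum.cong refl) (subst sum.cartesian_product, simp add: case_prod_unfold)
    finally show ?thesis .
  qed
  have four: "(\<Sum>e<4. F e) = F 0 + F 1 + F 2 + F 3" for F :: "nat \<Rightarrow> real"
    by (simp add: eval_nat_numeral)
  have "(LINT q:G_dom|lebesgue. f q * W_cal w q) = (\<Sum>p\<in>cub_nodes \<theta> n. \<omega> p * f p)" if f: "f \<in> Pi2 (4 * n - 1)" for f
  proof -
    have "(\<Sum>p\<in>cub_nodes \<theta> n. \<omega> p * f p) = (\<Sum>k=1..n. \<Sum>j=1..k. \<Sum>e<4. ?c (k, j, e) * f (?v (k, j, e)))"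
      unfolding \<omega>[of f, symmetric] by (rule triple)
    also have "\<dots> = (\<Sum>k=1..n. \<Sum>j=1..k. 1 / 4 * ((if j = k then 1 / 2 else 1) * (lam j * lam k *
      (f (s_node \<theta> j k, t_node \<theta> j k) + f (t_node \<theta> j k, s_node \<theta> j k)
        + f (- s_node \<theta> j k, - t_node \<theta> j k) + f (- t_node \<theta> j k, - s_node \<theta> j k)))) / (c_w w)\<^sup>2)"
      unfolding four by (intro sum.cong refl) (simp add: Let_def algebra_simps add_divide_distrib)
    also have "\<dots> = (c_w w)\<^sup>2 * (LINT q:G_dom|lebesgue. f q * W_cal w q) / (c_w w)\<^sup>2"
      unfolding cubature_formula[OF f] by (simp only: sum_divide_distrib sum_distrib_left)
    finally show ?thesis using c0 by simp
  qed
  then show ?thesis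
    using G_dom_integral(1)[OF w] cub_nodes_finite unfolding cubature_nodes_def by blast
qed

lemma cub_nodes_minimal: "minimal_cubature_nodes G_dom (W_cal w) (4 * n - 1) (cub_nodes \<theta> n)"
  unfolding minimal_cubature_nodes_def
proof (intro conjI allI impI cub_nodes_are_cubature_nodes)
  fix Y assume "cubature_nodes G_dom (W_cal w) (4 * n - 1) Y"
  then obtain \<omega> where fin: "finite Y" and
    \<omega>: "\<And>f. f \<in> Pi2 (4 * n - 1) \<Longrightarrow> (LINT p:G_dom|lebesgue. f p * W_cal w p) = (\<Sum>p\<in>Y. \<omega> p * f p)"
    unfolding cubature_nodes_def by blast
  have "2 * n * (n + 1) \<le> card Y"
  proof (rule moeller_bound[OF n fin, of "\<lambda>f. LINT p:G_dom|lebesgue. f p * W_cal w p"])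
    show "f p = 0" if "f \<in> Pi2 (2 * n - 1)" "(LINT p:G_dom|lebesgue. f p * f p * W_cal w p) = 0" for f p
      using G_dom_integral_definite[OF w that] .
  qed (rule \<omega>, assumption, rule G_dom_integral_odd[OF w])
  with card_cub_nodes_le show "card (cub_nodes \<theta> n) \<le> card Y" by linarith
qed

text \<open>\<open>Q1 P\<close> is invariant under the symmetries, so \<open>q\<close> may be
  replaced by its symmetrization, which comes from a polynomial on Omega of degree at most
  \<open>m div 2 < n\<close>, and \<open>P\<close> is orthogonal to that.\<close>

lemma Q1_orthogonal:
  assumes P: "P \<in> orth_polys Omega (W_mhalf w) n"
  shows "Q1 P \<in> orth_polys G_dom (W_cal w) (2 * n)"
proof -
  have Pn: "P \<in> Pi2 n" using P by (simp add: orth_polys_def)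
  have "set_integrable lebesgue G_dom (\<lambda>p. Q1 P p * q p * W_cal w p) \<and>
      (LINT p:G_dom|lebesgue. Q1 P p * q p * W_cal w p) = 0"
    if m: "m < 2 * n" and q: "q \<in> Pi2 m" for m q
  proof -
    have Pq: "(\<lambda>p. Q1 P p * q p) \<in> Pi2 (2 * n + m)" by (rule Pi2_mult[OF Q1_in_Pi2[OF Pn] q])
    obtain A where A: "A \<in> Pi2 (m div 2)"
      and qA: "\<And>x y. q (x, y) + q (y, x) + q (-x, -y) + q (-y, -x) = A (2 * x * y, x\<^sup>2 + y\<^sup>2 - 1)"
      using Pi2_symmetrize[OF q] by blast
    have "P (2 * x * y, x\<^sup>2 + y\<^sup>2 - 1) * (q (x, y) + q (y, x) + q (-x, -y) + q (-y, -x)) =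
        P (2 * x * y, x\<^sup>2 + y\<^sup>2 - 1) * A (2 * x * y, x\<^sup>2 + y\<^sup>2 - 1)" for x y
      by (simp only: qA)
    then have "Q1 P (x, y) * q (x, y) + Q1 P (y, x) * q (y, x) + Q1 P (-x, -y) * q (-x, -y) + Q1 P (-y, -x) * q (-y, -x) =
        (\<lambda>p. P p * A p) (2 * x * y, x\<^sup>2 + y\<^sup>2 - 1)" for x y
      by (simp add: Q1_def algebra_simps)
    then have "(LINT p:G_dom|lebesgue. Q1 P p * q p * W_cal w p) =
        1 / 4 * (LINT p:Omega|lebesgue. P p * A p * W_mhalf w p)"
      using G_dom_integral(2)[OF w Pq, of "\<lambda>p. P p * A p"] by simp
    also have "m div 2 < n" using m by simp
    then have "(LINT p:Omega|lebesgue. P p * A p * W_mhalf w p) = 0"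
      by (rule orth_polys_integral_eq_0[OF P A])
    finally show ?thesis using G_dom_integral(1)[OF w Pq] by simp
  qed
  then show ?thesis using Q1_in_Pi2[OF Pn] by (simp add: orth_polys_def)
qed

text \<open>If the degree dropped, \<open>Q1 P\<close> would be orthogonal to itself; but the
  integral of its square over G equals that of \<open>P\<close> over Omega, which is 1.\<close>

lemma Q1_degree:
  assumes P: "P \<in> orth_polys Omega (W_mhalf w) n"
    and norm: "(LINT p:Omega|lebesgue. P p * P p * W_mhalf w p) = 1"
  shows "Q1 P \<notin> Pi2 (2 * n - 1)"
proof
  assume Q: "Q1 P \<in> Pi2 (2 * n - 1)"
  have "(LINT p:G_dom|lebesgue. Q1 P p * Q1 P p * W_cal w p) = 0"
    by (rule orth_polys_integral_eq_0[OF Q1_orthogonal[OF P] Q]) (use n in simp)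
  moreover have "(LINT p:G_dom|lebesgue. Q1 P p * Q1 P p * W_cal w p) =
      1 / 4 * (LINT p:Omega|lebesgue. 4 * (P p * P p) * W_mhalf w p)"
    by (rule G_dom_integral(2)[OF w Pi2_mult[OF Q Q]]) (simp add: Q1_def algebra_simps)
  ultimately show False using norm by (simp add: mult.assoc)
qed

lemma Q1_vanishes_on_nodes:
  assumes P: "P \<in> orth_polys Omega (W_mhalf w) n" and q: "q \<in> cub_nodes \<theta> n"
  shows "Q1 P q = 0"
proof -
  obtain k j where kj: "k \<in> {1..n}" "j \<in> {1..k}"
    and q': "q \<in> {(s_node \<theta> j k, t_node \<theta> j k), (t_node \<theta> j k, s_node \<theta> j k),
      (- s_node \<theta> j k, - t_node \<theta> j k), (- t_node \<theta> j k, - s_node \<theta> j k)}"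
    using q unfolding cub_nodes_def by blast
  then have j: "j \<in> {1..n}" by auto
  have "Q1 P q = P (2 * s_node \<theta> j k * t_node \<theta> j k, (s_node \<theta> j k)\<^sup>2 + (t_node \<theta> j k)\<^sup>2 - 1)"
    using q' by (auto simp: Q1_def mult.commute mult.left_commute add.commute)
  then show ?thesis
    using orth_poly_vanishes_at_gauss_pair[OF w n gauss inj P j kj(1)]
    by (simp only: node_identities[OF j kj(1)])
qed

end

theorem corollary3p6:
  fixes w :: "real \<Rightarrow> real" and n :: nat and p :: "real poly"
    and x lam \<theta> :: "nat \<Rightarrow> real" and P :: "nat \<Rightarrow> real \<times> real \<Rightarrow> real"
  assumes "weight_fun w" and "n \<ge> 1"
    and "orth_poly_deg w n p"
    and "bij_betw x {1..n} {t. poly p t = 0}"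
    and "gauss_weights w n x lam"
    and "\<And>k. k \<in> {1..n} \<Longrightarrow> \<theta> k > 0 \<and> x k = cosh (\<theta> k)"
    and "orthonormal_basis Omega (W_mhalf w) n P"
  shows "(\<forall>f \<in> Pi2 (4 * n - 1).
           set_integrable lebesgue G_dom (\<lambda>q. f q * W_cal w q) \<and>
           (c_w w)\<^sup>2 * (LINT q:G_dom|lebesgue. f q * W_cal w q) =
             1 / 4 * (\<Sum>k=1..n. \<Sum>j=1..k. (if j = k then 1 / 2 else 1) * (lam j * lam k *
               (f (s_node \<theta> j k, t_node \<theta> j k) + f (t_node \<theta> j k, s_node \<theta> j k)
                + f (- s_node \<theta> j k, - t_node \<theta> j k) + f (- t_node \<theta> j k, - s_node \<theta> j k))))) \<and>
         minimal_cubature_nodes G_dom (W_cal w) (4 * n - 1) (cub_nodes \<theta> n) \<and>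
         (\<forall>k\<le>n. Q1 (P k) \<in> orth_polys G_dom (W_cal w) (2 * n) \<and> Q1 (P k) \<notin> Pi2 (2 * n - 1)) \<and>
         (\<forall>k\<le>n. \<forall>q \<in> cub_nodes \<theta> n. Q1 (P k) q = 0)"
proof -
  have inj: "inj_on x {1..n}" using assms(4) by (rule bij_betw_imp_inj_on)
  have theta: "x k = cosh (\<theta> k)" if "k \<in> {1..n}" for k using assms(6)[OF that] by blast
  have P: "P k \<in> orth_polys Omega (W_mhalf w) n"
    and norm: "(LINT q:Omega|lebesgue. P k q * P k q * W_mhalf w q) = 1" if "k \<le> n" for k
    using assms(7) that unfolding orthonormal_basis_def by auto
  note ctx = assms(1,2,5) inj theta
  show ?thesis
    using G_dom_integral(1)[OF assms(1)] cubature_formula[OF ctx] cub_nodes_minimal[OF ctx]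
      Q1_orthogonal[OF ctx P] Q1_degree[OF ctx P norm] Q1_vanishes_on_nodes[OF ctx P]
    by (intro conjI ballI allI impI) blast+
qed

end
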